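(* Let $d\ge 1$ and let $\{\xi(z):z\in\mathbb{Z}^d\}$ be independent identically distributed random variables with distribution function $F(x)=P(\xi(0)\le x)=1-x^{-\alpha}$ for $x\ge 1$ (and $F(x)=0$ for $x<1$), for some $\alpha>d$. Let $U(t)$ be the total mass of the solution of the parabolic Anderson problem with potential $\xi$ and localized initial condition, and let $L_t=\frac1t\log U(t)$. Then, as $t\uparrow\infty$, $$L_t\left(\frac{t}{\log t}\right)^{-d/(\alpha-d)}\Rightarrow Y,$$ where $\Rightarrow$ denotes convergence in law and $Y$ is a positive random variable with $P(Y\le y)=\exp\{-\theta y^{d-\alpha}\}$ for $y>0$, with $$\theta:=\frac{(\alpha-d)^d\,2^d\,B(\alpha-d,d)}{d^d\,(d-1)!},$$ where $B$ denotes the beta function.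
   Context: The parabolic Anderson problem is the Cauchy problem $\partial_t u(t,z)=\Delta^{\mathrm d}u(t,z)+\xi(z)u(t,z)$ for $(t,z)\in(0,\infty)\times\mathbb{Z}^d$, $u(0,z)=\mathbf 1_0(z)$, where $(\Delta^{\mathrm d}f)(z)=\sum_{y\sim z}[f(y)-f(z)]$ is the discrete Laplacian (sum over the $2d$ nearest neighbours of $z$). For the potentials considered here it almost surely has a unique nonnegative solution $u$; its total mass is $U(t)=\sum_{z\in\mathbb{Z}^d}u(t,z)$. By the Feynman–Kac formula, $U(t)=\mathbb{E}_0[\exp\{\int_0^t\xi(X_s)\,ds\}]$, where $(X_s)_{s\ge0}$ is the continuous-time simple random walk on $\mathbb{Z}^d$ with generator $\Delta^{\mathrm d}$ (total jump rate $2d$), independent of $\xi$, started at $0$, and $\mathbb{E}_0$ denotes expectation over the walk only. *)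

theory Defs
  imports "HOL-Probability.Probability"
begin

text \<open>The lattice of dimension $d$ is the type \<open>int ^ 'd\<close>, with $d$ = \<open>CARD('d)\<close>.\<close>

definition nearest_neighbours :: "int ^ 'd \<Rightarrow> (int ^ 'd) set" where
  "nearest_neighbours z = {y. (\<Sum>i\<in>UNIV. \<bar>y $ i - z $ i\<bar>) = 1}"

definition discrete_laplacian :: "(int ^ 'd \<Rightarrow> real) \<Rightarrow> int ^ 'd \<Rightarrow> real" where
  "discrete_laplacian f z = (\<Sum>y\<in>nearest_neighbours z. f y - f z)"

text \<open>The differential equation is required at positive times only; the initial condition is
  attached to it by right-continuity at time \<open>0\<close>. Values at negative times are irrelevant.\<close>

definition pam_nonneg_solution ::
    "(int ^ 'd \<Rightarrow> real) \<Rightarrow> (real \<Rightarrow> int ^ 'd \<Rightarrow> real) \<Rightarrow> bool" where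
  "pam_nonneg_solution V v \<longleftrightarrow>
     (\<forall>t\<ge>0. \<forall>z. 0 \<le> v t z) \<and>
     (\<forall>z. v 0 z = (if z = 0 then 1 else 0)) \<and>
     (\<forall>z. ((\<lambda>t. v t z) \<longlongrightarrow> v 0 z) (at_right 0)) \<and>
     (\<forall>t>0. \<forall>z. ((\<lambda>s. v s z) has_real_derivative
                    (discrete_laplacian (v t) z + V z * v t z)) (at t))"

definition total_mass :: "(real \<Rightarrow> int ^ 'd \<Rightarrow> real) \<Rightarrow> real \<Rightarrow> real" where
  "total_mass v t = (\<Sum>\<^sub>\<infinity>z\<in>UNIV. v t z)"

text \<open>Convergence in law along a filter: \<^const>\<open>weak_conv_m\<close>, which is restricted to sequences,
  with \<^const>\<open>sequentially\<close> replaced by \<open>F\<close>. Measurability is demanded explicitly because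
  \<^const>\<open>distr\<close> is meaningless for non-measurable functions.\<close>

definition converges_in_law ::
    "'a measure \<Rightarrow> ('t \<Rightarrow> 'a \<Rightarrow> real) \<Rightarrow> 't filter \<Rightarrow> 'b measure \<Rightarrow> ('b \<Rightarrow> real) \<Rightarrow> bool" where
  "converges_in_law M X F N Y \<longleftrightarrow>
     (\<forall>\<^sub>F t in F. X t \<in> borel_measurable M) \<and> Y \<in> borel_measurable N \<and>
     (\<forall>x. isCont (cdf (distr N borel Y)) x \<longrightarrow>
        ((\<lambda>t. cdf (distr M borel (X t)) x) \<longlongrightarrow> cdf (distr N borel Y) x) F)"

definition theta :: "nat \<Rightarrow> real \<Rightarrow> real" where
  "theta d \<alpha> = (\<alpha> - real d) ^ d * 2 ^ d * Beta (\<alpha> - real d) (real d)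
                / (real d ^ d * fact (d - 1))"

end

theory Submission
  imports Defs "HOL-Real_Asymp.Real_Asymp"
begin

text \<open>The growth rate is decided by a competition between single sites. A walk that runs straight to a
site \<open>z\<close> and stays there contributes about \<open>exp (t * \<xi> z - l1 z * ln (\<xi> z))\<close> to the total mass. With
\<open>q = d / (\<alpha> - d)\<close>, \<open>a = (t / ln t) powr q\<close> and \<open>r = a * t / ln t\<close>, the relevant sites have distance of
order \<open>r\<close> and potential of order \<open>a\<close>, and \<open>ln (\<xi> z)\<close> is about \<open>q * ln t\<close>. Since \<open>a * t = r * ln t\<close>, the
growth rate divided by \<open>a\<close> should behave like the maximum of \<open>\<xi> z / a - q * l1 z / r\<close> over all sites
\<open>z\<close>. This maximum is at most \<open>y\<close> precisely if \<open>\<xi> z \<le> a * (y + q * l1 z / r)\<close> for all \<open>z\<close>, that is, if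
the potential lies below a cone. By independence, and as \<open>a powr \<alpha> = r ^ d\<close>, the probability of this event
is about \<open>exp (- (\<Sum>z. (y + q * l1 z / r) powr (- \<alpha>)) / r ^ d)\<close>. The exponent is a Riemann sum, and its limit
is \<open>theta d \<alpha> * y powr (d - \<alpha>)\<close>.

The maximum is compared with the growth rate by estimates for nonnegative solutions of the
differential equation, without the Feynman-Kac formula. The lower estimate \<open>v_lower\<close> follows the mass
along one path. For the upper estimate, suppose that \<open>V z \<le> A + B * l1 z\<close>. Then
\<open>exp ((A + B * l1 z) * s + D * s * exp (B * s))\<close> is a supersolution, and pairing it with the solution
suggests \<open>total_mass_upper\<close>: the total mass is at most \<open>exp (A * t + D * t * exp (B * t))\<close>. For a cone with
factor \<open>k < 1\<close> one has \<open>A = k * a * y\<close> and \<open>exp (B * t) = t powr (k * q)\<close>, so that the second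
summand is negligible compared with \<open>t * a\<close>. The pairing needs control at infinity of a solution about
which nothing but nonnegativity is known. Nonnegativity suffices: a large value at a distant site
would arrive at the origin later, which gives a factorial growth bound (\<open>v_growth\<close>), and a truncation
of the supersolution that decays factorially (\<open>supersol\<close>) beats this bound.

The Riemann sum is evaluated without counting lattice points (\<open>lattice_sum\<close>): the Gamma integral
writes each power as a mixture of exponentials of the \<open>l1\<close> norm, whose sum over the lattice is the
\<open>d\<close>-th power of a geometric series.

Up to factors \<open>k < 1\<close> and \<open>k > 1\<close> in front of the cone the event for the growth rate is thus enclosed
between two events for independent variables (\<open>prob_lower_bound\<close>, \<open>prob_upper_bound\<close>), and
\<open>k \<rightarrow> 1\<close> gives the limit.\<close>

section \<open>The lattice and its \<open>l1\<close> norm\<close>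

definition l1 :: "int ^ 'd \<Rightarrow> nat" where
  "l1 z = nat (\<Sum>i\<in>UNIV. \<bar>z $ i\<bar>)"

lemma int_l1: "int (l1 z) = (\<Sum>i\<in>UNIV. \<bar>z $ i\<bar>)"
  by (simp add: l1_def sum_nonneg)

lemma real_l1: "real (l1 z) = (\<Sum>i\<in>UNIV. \<bar>real_of_int (z $ i)\<bar>)"
proof -
  have "real (l1 z) = real_of_int (int (l1 z))" by simp
  also have "\<dots> = (\<Sum>i\<in>UNIV. \<bar>real_of_int (z $ i)\<bar>)" unfolding int_l1 by simp
  finally show ?thesis .
qed

lemma nearest_neighbours_iff: "y \<in> nearest_neighbours z \<longleftrightarrow> l1 (y - z) = 1"
  using int_l1[of "y - z"] by (auto simp: nearest_neighbours_def)

lemma l1_0 [simp]: "l1 0 = 0"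
  by (simp add: l1_def)

lemma l1_eq_0_iff [simp]: "l1 z = 0 \<longleftrightarrow> z = 0"
proof
  assume "l1 z = 0"
  then have "(\<Sum>i\<in>UNIV. \<bar>z $ i\<bar>) = 0" using int_l1[of z] by simp
  then show "z = 0" by (simp add: sum_nonneg_eq_0_iff vec_eq_iff)
qed simp

lemma l1_minus_commute: "l1 (y - z) = l1 (z - y)"
  by (simp add: l1_def abs_minus_commute)

lemma l1_triangle: "l1 (y + z) \<le> l1 y + l1 z"
proof -
  have "int (l1 (y + z)) \<le> int (l1 y) + int (l1 z)"
    unfolding int_l1 sum.distrib[symmetric] by (intro sum_mono) auto
  then show ?thesis by simp
qed

lemma l1_nearest_neighbours:
  assumes "y \<in> nearest_neighbours z"
  shows "l1 y \<le> l1 z + 1"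
  using l1_triangle[of "y - z" z] assms by (simp add: nearest_neighbours_iff)

lemma nearest_neighbours_sym: "y \<in> nearest_neighbours z \<longleftrightarrow> z \<in> nearest_neighbours y"
  by (simp add: nearest_neighbours_iff l1_minus_commute)

lemma l1_axis_step:
  assumes "w $ i \<noteq> 0"
  shows "l1 (w - axis i (sgn (w $ i))) + 1 = l1 w"
proof -
  have "int (l1 (w - axis i (sgn (w $ i)))) = \<bar>w $ i - sgn (w $ i)\<bar> + (\<Sum>j\<in>UNIV-{i}. \<bar>w $ j\<bar>)"
    unfolding int_l1 by (subst sum.remove[of _ i]) (auto simp: axis_def intro!: sum.cong)
  moreover have "int (l1 w) = \<bar>w $ i\<bar> + (\<Sum>j\<in>UNIV-{i}. \<bar>w $ j\<bar>)"
    unfolding int_l1 by (subst sum.remove[of _ i]) auto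
  moreover have "\<bar>w $ i - sgn (w $ i)\<bar> + 1 = \<bar>w $ i\<bar>"
    using assms by (auto simp: sgn_if)
  ultimately show ?thesis by linarith
qed

lemma l1_axis: "l1 (axis i c) = nat \<bar>c\<bar>"
proof -
  have "int (l1 (axis i c)) = \<bar>c\<bar>"
    unfolding int_l1 by (subst sum.remove[of _ i]) (auto simp: axis_def)
  then show ?thesis by simp
qed

lemma l1_SucE:
  assumes "l1 (z - y) = Suc n"
  obtains z' where "z' \<in> nearest_neighbours z" "l1 (z' - y) = n"
proof -
  have "z - y \<noteq> 0" using assms by auto
  then obtain i where i: "(z - y) $ i \<noteq> 0" by (auto simp: vec_eq_iff)
  define e where "e = axis i (sgn ((z - y) $ i))"
  have "l1 e = 1" using i by (simp add: e_def l1_axis sgn_if)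
  then have "z - e \<in> nearest_neighbours z"
    using l1_minus_commute[of "z - e" z] by (simp add: nearest_neighbours_iff)
  moreover have "l1 (z - e - y) = n"
    using l1_axis_step[OF i] assms by (simp add: e_def algebra_simps)
  ultimately show thesis using that by blast
qed

lemma nearest_neighbours_0:
  "nearest_neighbours (0 :: int ^ 'd) = (\<lambda>(i, s). axis i s) ` (UNIV \<times> {1, -1})"
proof (intro set_eqI iffI)
  fix e :: "int ^ 'd" assume "e \<in> nearest_neighbours 0"
  then have e: "l1 e = 1" by (simp add: nearest_neighbours_iff)
  then have "e \<noteq> 0" by auto
  then obtain i where i: "e $ i \<noteq> 0" by (auto simp: vec_eq_iff)
  have "e = axis i (sgn (e $ i))" using l1_axis_step[OF i] e by simp
  moreover have "sgn (e $ i) \<in> {1, -1}" using i by (auto simp: sgn_if)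
  ultimately show "e \<in> (\<lambda>(i, s). axis i s) ` (UNIV \<times> {1, -1})" by force
qed (auto simp: nearest_neighbours_iff l1_axis)

lemma nearest_neighbours_translate: "nearest_neighbours z = (+) z ` nearest_neighbours 0"
  by (auto simp: nearest_neighbours_iff image_iff intro!: bexI[of _ "_ - z"])

lemma finite_nearest_neighbours [simp]: "finite (nearest_neighbours z)"
  by (subst nearest_neighbours_translate) (simp add: nearest_neighbours_0)

lemma card_nearest_neighbours:
  "card (nearest_neighbours (z :: int ^ 'd)) = 2 * CARD('d)"
proof -
  have "inj_on (\<lambda>(i, s). axis i s :: int ^ 'd) (UNIV \<times> {1, -1})"
    by (auto simp: inj_on_def axis_eq_axis)
  then have "card (nearest_neighbours (0 :: int ^ 'd)) = CARD('d) * 2"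
    unfolding nearest_neighbours_0 by (subst card_image) (auto simp: card_cartesian_product)
  then show ?thesis
    by (subst nearest_neighbours_translate) (simp add: card_image)
qed

definition l1_ball :: "nat \<Rightarrow> (int ^ 'd) set" where
  "l1_ball n = {z. l1 z \<le> n}"

lemma l1_ball_0 [simp]: "l1_ball 0 = {0}"
  by (auto simp: l1_ball_def)

lemma l1_ball_Suc: "l1_ball (Suc n) \<subseteq> (\<Union>z\<in>l1_ball n. insert z (nearest_neighbours z))"
proof
  fix z :: "int ^ 'd" assume z: "z \<in> l1_ball (Suc n)"
  show "z \<in> (\<Union>z\<in>l1_ball n. insert z (nearest_neighbours z))"
  proof (cases "l1 z \<le> n")
    case False
    with z have "l1 (z - 0) = Suc n" by (simp add: l1_ball_def)
    then obtain z' where "z' \<in> nearest_neighbours z" "l1 (z' - 0) = n" by (rule l1_SucE)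
    then show ?thesis by (auto simp: l1_ball_def nearest_neighbours_sym[of z' z])
  qed (auto simp: l1_ball_def)
qed

lemma finite_l1_ball [simp]: "finite (l1_ball n)"
proof (induction n)
  case (Suc n)
  show ?case by (rule finite_subset[OF l1_ball_Suc]) (use Suc in auto)
qed simp

text \<open>The exponential bound is far from sharp, but it only has to be beaten by a geometric factor whose
ratio can be made as small as desired, and it needs nothing beyond the degree of the lattice.\<close>
lemma card_l1_ball: "card (l1_ball n :: (int ^ 'd) set) \<le> (1 + 2 * CARD('d)) ^ n"
proof (induction n)
  case (Suc n)
  have "card (l1_ball (Suc n) :: (int ^ 'd) set)
      \<le> card (\<Union>z\<in>(l1_ball n :: (int ^ 'd) set). insert z (nearest_neighbours z))"
    by (rule card_mono[OF _ l1_ball_Suc]) auto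
  also have "\<dots> \<le> (\<Sum>z\<in>(l1_ball n :: (int ^ 'd) set). card (insert z (nearest_neighbours z)))"
    by (rule card_UN_le) simp
  also have "\<dots> \<le> (\<Sum>z\<in>(l1_ball n :: (int ^ 'd) set). 1 + 2 * CARD('d))"
    by (intro sum_mono) (metis card_insert_le_m1 card_nearest_neighbours card_insert_if finite_nearest_neighbours le_add2 plus_1_eq_Suc le_refl)
  also have "\<dots> \<le> (1 + 2 * CARD('d)) ^ Suc n"
    using mult_right_mono[OF Suc, of "1 + 2 * CARD('d)"] by (simp add: mult.commute)
  finally show ?case .
qed simp

lemma finite_l1_le: "finite {z :: int ^ 'd. real (l1 z) \<le> c}"
  by (rule finite_subset[OF _ finite_l1_ball[of "nat \<lfloor>c\<rfloor>"]]) (auto simp: l1_ball_def le_nat_floor)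

lemma finite_subset_l1_ball:
  assumes "finite (S :: (int ^ 'd) set)"
  obtains k where "S \<subseteq> l1_ball k"
proof -
  have "S \<subseteq> l1_ball (Max (insert 0 (l1 ` S)))" using assms by (auto simp: l1_ball_def)
  then show thesis using that by blast
qed

section \<open>Lower bounds for nonnegative solutions\<close>

locale pam =
  fixes V :: "int ^ 'd \<Rightarrow> real" and v :: "real \<Rightarrow> int ^ 'd \<Rightarrow> real"
  assumes sol: "pam_nonneg_solution V v" and V_nonneg: "\<And>z. 0 \<le> V z"
begin

text \<open>The total jump rate of the simple random walk generated by the discrete Laplacian.\<close>
definition D :: real where "D = 2 * real CARD('d)"

lemma D_pos: "0 < D"
  by (simp add: D_def)

lemma v_nonneg: "0 \<le> t \<Longrightarrow> 0 \<le> v t z"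
  using sol by (simp add: pam_nonneg_solution_def)

lemma v_0: "v 0 z = (if z = 0 then 1 else 0)"
  using sol by (simp add: pam_nonneg_solution_def)

lemma v_deriv:
  assumes "0 < t"
  shows "((\<lambda>s. v s z) has_real_derivative
           (\<Sum>y\<in>nearest_neighbours z. v t y) - D * v t z + V z * v t z) (at t)"
proof -
  have "discrete_laplacian (v t) z = (\<Sum>y\<in>nearest_neighbours z. v t y) - D * v t z"
    by (simp add: discrete_laplacian_def sum_subtractf card_nearest_neighbours D_def)
  moreover have "((\<lambda>s. v s z) has_real_derivative discrete_laplacian (v t) z + V z * v t z) (at t)"
    using sol assms unfolding pam_nonneg_solution_def by blast
  ultimately show ?thesis by simp
qed

lemma v_continuous: "0 \<le> a \<Longrightarrow> continuous_on {a..b} (\<lambda>t. v t z)"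
proof (unfold continuous_on_def, safe)
  fix t assume t: "0 \<le> a" "t \<in> {a..b}"
  show "((\<lambda>t. v t z) \<longlongrightarrow> v t z) (at t within {a..b})"
  proof (cases "t = 0")
    case True
    have "((\<lambda>t. v t z) \<longlongrightarrow> v 0 z) (at_right 0)"
      using sol unfolding pam_nonneg_solution_def by blast
    then have "((\<lambda>t. v t z) \<longlongrightarrow> v 0 z) (at 0 within {0..})"
      by (simp add: at_within_Ici_at_right)
    then show ?thesis unfolding True by (rule tendsto_within_subset) (use t in auto)
  next
    case False
    then have "isCont (\<lambda>t. v t z) t" using v_deriv[of t z] t DERIV_isCont by fastforce
    then show ?thesis unfolding continuous_at by (rule tendsto_within_subset) simp
  qed
qed

text \<open>The mass at \<open>y\<close> at time \<open>s\<close> is transported to \<open>z\<close> along a single shortest path, ignoring all other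
paths and the nonnegative potential; \<open>(t - s) ^ n / fact n\<close> is the volume of the simplex of jump
times. The induction moves the endpoint one step towards \<open>y\<close>: after multiplication by
\<open>exp (D * t)\<close> the value at \<open>z\<close> grows at least as fast as the value at the preceding site.\<close>
lemma v_path_lower:
  assumes "0 \<le> s" "s \<le> t" "l1 (z - y) = n"
  shows "v s y * (t - s) ^ n / fact n \<le> exp (D * (t - s)) * v t z"
  using assms(2,3)
proof (induction n arbitrary: z t)
  case 0
  then have [simp]: "z = y" using l1_eq_0_iff[of "z - y"] by simp
  have "exp (D * s) * v s z \<le> exp (D * t) * v t z"
  proof (rule DERIV_nonneg_imp_increasing_open[OF 0(1)])
    fix x assume x: "s < x" "x < t"
    have "((\<lambda>x. exp (D * x) * v x z) has_real_derivative
             exp (D * x) * ((\<Sum>y\<in>nearest_neighbours z. v x y) + V z * v x z)) (at x)"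
      using x assms by (auto intro!: derivative_eq_intros v_deriv simp: algebra_simps)
    moreover have "0 \<le> exp (D * x) * ((\<Sum>y\<in>nearest_neighbours z. v x y) + V z * v x z)"
      using x assms V_nonneg by (intro mult_nonneg_nonneg add_nonneg_nonneg sum_nonneg v_nonneg) auto
    ultimately show "\<exists>y. ((\<lambda>x. exp (D * x) * v x z) has_real_derivative y) (at x) \<and> 0 \<le> y" by blast
  qed (intro continuous_intros v_continuous assms)
  then have "exp (D * s) * v s z \<le> exp (D * s) * (exp (D * (t - s)) * v t z)"
    by (simp add: mult.assoc[symmetric] exp_add[symmetric] algebra_simps)
  then show ?case by simp
next
  case (Suc n)
  obtain z' where z': "z' \<in> nearest_neighbours z" "l1 (z' - y) = n"
    by (rule l1_SucE[OF Suc(3)])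
  define c where "c = v s y"
  let ?f = "\<lambda>x. exp (D * x) * v x z - exp (D * s) * c * (x - s) ^ Suc n / fact (Suc n)"
  have "?f s \<le> ?f t"
  proof (rule DERIV_nonneg_imp_increasing_open[OF Suc(2)])
    fix x assume x: "s < x" "x < t"
    have "(?f has_real_derivative
             exp (D * x) * ((\<Sum>y\<in>nearest_neighbours z. v x y) + V z * v x z)
              - exp (D * s) * c * (x - s) ^ n / fact n) (at x)"
      using x assms
      by (auto intro!: derivative_eq_intros v_deriv simp del: power_Suc of_nat_Suc)
         (simp add: field_simps del: of_nat_Suc)
    moreover have "exp (D * s) * c * (x - s) ^ n / fact n
        \<le> exp (D * x) * ((\<Sum>y\<in>nearest_neighbours z. v x y) + V z * v x z)"
    proof -
      have "exp (D * s) * (c * (x - s) ^ n / fact n) \<le> exp (D * s) * (exp (D * (x - s)) * v x z')"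
        unfolding c_def by (intro mult_left_mono Suc.IH z') (use x in auto)
      also have "\<dots> = exp (D * x) * v x z'"
        by (simp add: mult.assoc[symmetric] exp_add[symmetric] algebra_simps)
      also have "v x z' \<le> (\<Sum>y\<in>nearest_neighbours z. v x y)"
        using x assms z' by (intro member_le_sum v_nonneg) auto
      also have "(\<Sum>y\<in>nearest_neighbours z. v x y) \<le> (\<Sum>y\<in>nearest_neighbours z. v x y) + V z * v x z"
        using x assms V_nonneg v_nonneg by simp
      finally show ?thesis by (simp add: mult.assoc)
    qed
    ultimately show "\<exists>y. (?f has_real_derivative y) (at x) \<and> 0 \<le> y" by fastforce
  qed (intro continuous_intros v_continuous assms, auto)
  moreover have "0 \<le> exp (D * s) * v s z" using assms v_nonneg by simp
  ultimately have "exp (D * s) * (c * (t - s) ^ Suc n / fact (Suc n)) \<le> exp (D * t) * v t z"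
    by (simp add: mult.assoc)
  also have "\<dots> = exp (D * s) * (exp (D * (t - s)) * v t z)"
    by (simp add: mult.assoc[symmetric] exp_add[symmetric] algebra_simps)
  finally have "exp (D * s) * (c * (t - s) ^ Suc n / fact (Suc n)) \<le> exp (D * s) * (exp (D * (t - s)) * v t z)" .
  then show ?case unfolding c_def by (rule mult_left_le_imp_le) simp
qed

text \<open>The contribution of the walk that does not leave \<open>z\<close> between the times \<open>s\<close> and \<open>t\<close>.\<close>
lemma v_stay_lower:
  assumes "0 \<le> s" "s \<le> t"
  shows "exp ((V z - D) * (t - s)) * v s z \<le> v t z"
proof -
  have "exp ((D - V z) * s) * v s z \<le> exp ((D - V z) * t) * v t z"
  proof (rule DERIV_nonneg_imp_increasing_open[OF assms(2)])
    fix x assume x: "s < x" "x < t"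
    have "((\<lambda>x. exp ((D - V z) * x) * v x z) has_real_derivative
             exp ((D - V z) * x) * (\<Sum>y\<in>nearest_neighbours z. v x y)) (at x)"
      using x assms by (auto intro!: derivative_eq_intros v_deriv simp: algebra_simps)
    moreover have "0 \<le> exp ((D - V z) * x) * (\<Sum>y\<in>nearest_neighbours z. v x y)"
      using x assms by (intro mult_nonneg_nonneg sum_nonneg v_nonneg) auto
    ultimately show "\<exists>y. ((\<lambda>x. exp ((D - V z) * x) * v x z) has_real_derivative y) (at x) \<and> 0 \<le> y"
      by blast
  qed (intro continuous_intros v_continuous assms)
  then have "exp ((V z - D) * t) * (exp ((D - V z) * s) * v s z)
      \<le> exp ((V z - D) * t) * (exp ((D - V z) * t) * v t z)"
    by (rule mult_left_mono) simp
  moreover have "exp ((V z - D) * t) * exp ((D - V z) * s) = exp ((V z - D) * (t - s))"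
    unfolding exp_add[symmetric] by (rule arg_cong[where f = exp]) algebra
  moreover have "exp ((V z - D) * t) * exp ((D - V z) * t) = 1"
    unfolding exp_add[symmetric] exp_eq_one_iff by algebra
  ultimately show ?thesis by (simp only: mult.assoc[symmetric] mult_1_left)
qed

text \<open>The strategy behind the lower bound on the total mass: run straight to \<open>z\<close>, then stay there. The
arrival time \<open>s = n / V z\<close> maximises \<open>s ^ n * exp (- s * V z)\<close>, the factor by which the cost of the
run and the loss of time at \<open>z\<close> depend on \<open>s\<close>; the assumption says that this time is available.\<close>
lemma v_lower:
  assumes "0 < V z" "real (l1 z) \<le> t * V z"
  shows "exp (t * V z - real (l1 z) * ln (V z) - real (l1 z) - D * t) \<le> v t z"
proof -
  define n where "n = l1 z"
  define s where "s = real n / V z"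
  have s: "0 \<le> s" "s \<le> t" "s * V z = real n" using assms by (auto simp: s_def n_def field_simps)
  have "exp (- real n * ln (V z)) * fact n \<le> s ^ n"
  proof -
    have "exp (- real n * ln (V z)) = inverse (V z ^ n)"
      using assms by (simp add: exp_minus exp_of_nat_mult)
    then have "exp (- real n * ln (V z)) * fact n \<le> inverse (V z ^ n) * real n ^ n"
      using fact_le_power[of n, where ?'a = real] assms by (intro mult_mono) auto
    also have "\<dots> = s ^ n" by (simp add: s_def power_divide field_simps)
    finally show ?thesis .
  qed
  then have "exp (- real n * ln (V z)) \<le> s ^ n / fact n" by (simp add: field_simps)
  also have "\<dots> \<le> exp (D * s) * v s z"
    using v_path_lower[of 0 s z 0 n] s by (simp add: v_0 n_def)
  finally have "exp ((V z - D) * (t - s)) * exp (- D * s) * exp (- real n * ln (V z))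
       \<le> exp ((V z - D) * (t - s)) * exp (- D * s) * (exp (D * s) * v s z)"
    by (intro mult_left_mono) auto
  also have "\<dots> = exp ((V z - D) * (t - s)) * v s z"
    by (simp add: exp_minus field_simps)
  also have "\<dots> \<le> v t z" using s by (intro v_stay_lower) auto
  also have "exp ((V z - D) * (t - s)) * exp (- D * s) * exp (- real n * ln (V z))
      = exp (t * V z - real n * ln (V z) - real n - D * t)"
    unfolding exp_add[symmetric] s(3)[symmetric] by (rule arg_cong[where f = exp]) algebra
  finally show ?thesis unfolding n_def .
qed

end

section \<open>A supersolution and the upper bound for the total mass\<close>

text \<open>
The tail of the exponential series. It interpolates between the full exponential, which gives
the bound that is wanted, and a function that decays like \<open>x ^ l / fact l\<close>, which is needed to discard
boundary terms far away from the origin.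
\<close>
definition exp_tail :: "nat \<Rightarrow> real \<Rightarrow> real" where
  "exp_tail l x = exp x - (\<Sum>n<l. x ^ n / fact n)"

lemma exp_tail_0 [simp]: "exp_tail 0 x = exp x"
  by (simp add: exp_tail_def)

lemma exp_tail_at_0: "exp_tail l 0 = (if l = 0 then 1 else 0)"
  by (cases l) (simp_all add: exp_tail_def sum.lessThan_Suc_shift del: sum.lessThan_Suc)

lemma exp_tail_sums: "(\<lambda>n. x ^ (n + l) / fact (n + l)) sums exp_tail l x"
proof -
  have "(\<lambda>n. x ^ n / fact n) sums exp x"
    using exp_converges[of x] by (simp add: divide_inverse mult.commute)
  from sums_split_initial_segment[OF this, of l] show ?thesis
    by (simp add: exp_tail_def)
qed

lemma exp_tail_nonneg: "0 \<le> x \<Longrightarrow> 0 \<le> exp_tail l x"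
  using sums_le[OF _ sums_zero exp_tail_sums] by simp

lemma exp_tail_antimono: "0 \<le> x \<Longrightarrow> l \<le> k \<Longrightarrow> exp_tail k x \<le> exp_tail l x"
  unfolding exp_tail_def by (intro diff_mono sum_mono2) auto

lemma exp_tail_mono:
  assumes "0 \<le> x" "x \<le> y"
  shows "exp_tail l x \<le> exp_tail l y"
  by (rule sums_le[OF _ exp_tail_sums exp_tail_sums])
     (use assms in \<open>auto intro!: divide_right_mono power_mono\<close>)

lemma exp_tail_upper:
  assumes "0 \<le> x"
  shows "exp_tail l x \<le> x ^ l / fact l * exp x"
proof (rule sums_le[OF _ exp_tail_sums])
  show "(\<lambda>n. x ^ l / fact l * (x ^ n / fact n)) sums (x ^ l / fact l * exp x)"
    using exp_tail_sums[of x 0] by (intro sums_mult) simp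
  fix n
  have "fact l * fact n \<le> (fact (n + l) :: nat)"
    using fact_fact_dvd_fact[of l n, where ?'a = nat] by (intro dvd_imp_le) (simp_all add: add.commute)
  then have "fact l * fact n \<le> (fact (n + l) :: real)"
    using of_nat_mono by fastforce
  then show "x ^ (n + l) / fact (n + l) \<le> x ^ l / fact l * (x ^ n / fact n)"
    using assms by (simp add: power_add mult.commute frac_le)
qed

lemma exp_tail_deriv [derivative_intros]:
  assumes "(f has_real_derivative f') (at x)"
  shows "((\<lambda>x. exp_tail l (f x)) has_real_derivative exp_tail (l - 1) (f x) * f') (at x)"
proof -
  have "(exp_tail l has_real_derivative exp_tail (l - 1) y) (at y)" for y
  proof (cases l)
    case (Suc m)
    have "((\<lambda>y. \<Sum>n<Suc m. y ^ n / fact n) has_real_derivative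
        (\<Sum>n<Suc m. real n * y ^ (n - 1) / fact n)) (at y)"
      by (auto intro!: derivative_eq_intros)
    also have "(\<Sum>n<Suc m. real n * y ^ (n - 1) / fact n) = (\<Sum>n<m. y ^ n / fact n)"
      by (simp add: sum.lessThan_Suc_shift field_simps del: sum.lessThan_Suc of_nat_Suc)
    finally have "((\<lambda>y. exp y - (\<Sum>n<Suc m. y ^ n / fact n)) has_real_derivative
        exp y - (\<Sum>n<m. y ^ n / fact n)) (at y)"
      by (intro DERIV_diff DERIV_exp)
    then show ?thesis by (simp add: exp_tail_def[abs_def] Suc del: sum.lessThan_Suc)
  qed (simp add: exp_tail_def[abs_def])
  from DERIV_chain2[OF this assms] show ?thesis .
qed

context pam
begin

text \<open>Expanding over the number \<open>n\<close> of jumps, a walk that starts at \<open>z\<close> and makes \<open>n\<close> jumps sees potential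
values at most \<open>A + B * (l1 z + n)\<close>, so its contribution up to time \<open>s\<close> is at most
\<open>exp ((A + B * (l1 z + n)) * s) * (D * s) ^ n / fact n\<close>. Summing only over those \<open>n\<close> that allow the walk
to reach the ball of radius \<open>k\<close> gives this function. It therefore dominates the solution that
starts from the indicator of that ball, and it decays superexponentially away from the ball.\<close>
definition supersol :: "real \<Rightarrow> real \<Rightarrow> nat \<Rightarrow> real \<Rightarrow> int ^ 'd \<Rightarrow> real" where
  "supersol A B k s z =
     exp ((A + B * real (l1 z)) * s) * exp_tail (l1 z - k) (D * s * exp (B * s))"

lemma supersol_nonneg: "0 \<le> s \<Longrightarrow> 0 \<le> supersol A B k s z"
  unfolding supersol_def using D_pos by (intro mult_nonneg_nonneg exp_tail_nonneg) auto

lemma supersol_start: "supersol A B k 0 z = (if l1 z \<le> k then 1 else 0)"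
  by (simp add: supersol_def exp_tail_at_0)

text \<open>A step to a neighbour costs at most a factor \<open>exp (B * s)\<close> in front of the tail and lowers the index
of the tail by at most one, as the time derivative of the tail does.\<close>
lemma supersol_deriv:
  assumes "0 \<le> s" "0 \<le> A" "0 \<le> B" and V_le: "V z \<le> A + B * real (l1 z)"
  obtains g' where "((\<lambda>s. supersol A B k s z) has_real_derivative g') (at s)"
    and "V z * supersol A B k s z + (\<Sum>y\<in>nearest_neighbours z. supersol A B k s y) \<le> g'"
proof -
  define x where "x = D * s * exp (B * s)"
  define l where "l = l1 z - k"
  define E where "E = exp ((A + B * real (l1 z)) * s)"
  define g' where "g' = (A + B * real (l1 z)) * (E * exp_tail l x)
        + E * (exp_tail (l - 1) x * (D * exp (B * s) * (1 + B * s)))"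
  have x: "0 \<le> x" using assms D_pos by (simp add: x_def)
  have E: "0 \<le> E" by (simp add: E_def)
  have "((\<lambda>s. supersol A B k s z) has_real_derivative g') (at s)"
    unfolding supersol_def
    by (rule derivative_eq_intros refl)+ (simp add: g'_def E_def x_def l_def algebra_simps)
  moreover have "V z * supersol A B k s z + (\<Sum>y\<in>nearest_neighbours z. supersol A B k s y) \<le> g'"
  proof -
    have "supersol A B k s y \<le> E * exp (B * s) * exp_tail (l - 1) x"
      if "y \<in> nearest_neighbours z" for y
    proof -
      have yz: "l1 y \<le> l1 z + 1" "l1 z \<le> l1 y + 1"
        using that l1_nearest_neighbours nearest_neighbours_sym by blast+
      have "B * real (l1 y) \<le> B * real (l1 z + 1)" using yz assms by (intro mult_left_mono) simp_all
      then have "(A + B * real (l1 y)) * s \<le> (A + B * real (l1 z) + B) * s"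
        using assms by (intro mult_right_mono) (simp_all add: algebra_simps)
      then have "exp ((A + B * real (l1 y)) * s) \<le> E * exp (B * s)"
        by (simp add: E_def exp_add[symmetric] algebra_simps)
      moreover have "exp_tail (l1 y - k) x \<le> exp_tail (l - 1) x"
        using yz by (intro exp_tail_antimono x) (simp add: l_def)
      ultimately show ?thesis
        unfolding supersol_def x_def[symmetric] using exp_tail_nonneg[OF x] E
        by (intro mult_mono) auto
    qed
    then have "(\<Sum>y\<in>nearest_neighbours z. supersol A B k s y)
        \<le> (\<Sum>y\<in>nearest_neighbours z. E * exp (B * s) * exp_tail (l - 1) x)"
      by (rule sum_mono)
    also have "\<dots> = E * exp_tail (l - 1) x * (D * exp (B * s))"
      by (simp add: card_nearest_neighbours D_def)
    also have "\<dots> \<le> E * exp_tail (l - 1) x * (D * exp (B * s) * (1 + B * s))"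
      using E exp_tail_nonneg[OF x] D_pos assms by (intro mult_left_mono) auto
    finally have "(\<Sum>y\<in>nearest_neighbours z. supersol A B k s y)
        \<le> E * exp_tail (l - 1) x * (D * exp (B * s) * (1 + B * s))" .
    moreover have "V z * supersol A B k s z \<le> (A + B * real (l1 z)) * supersol A B k s z"
      using V_le supersol_nonneg[OF assms(1)] by (rule mult_right_mono)
    ultimately show ?thesis
      unfolding g'_def supersol_def[of A B k s z] E_def[symmetric] x_def[symmetric] l_def[symmetric]
      by (simp only: mult.assoc add_mono)
  qed
  ultimately show thesis by (rule that)
qed

text \<open>No growth condition is imposed on the solution, but positivity provides one: mass at a distant
site \<open>y\<close> at time \<open>s\<close> would travel to the origin by the later time \<open>T\<close>, where it is bounded by the
finite number \<open>v T 0\<close>. The denominator improves as \<open>T\<close> grows, at the expense of the prefactor only.\<close>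
lemma v_growth:
  assumes "0 \<le> s" "s \<le> t" "t < T"
  shows "v s y \<le> v T 0 * exp (D * T) * fact (l1 y) / (T - t) ^ l1 y"
proof -
  have "v s y * (T - t) ^ l1 y \<le> v s y * (T - s) ^ l1 y"
    using assms v_nonneg by (intro mult_left_mono power_mono) auto
  also have "\<dots> = v s y * (T - s) ^ l1 y / fact (l1 y) * fact (l1 y)" by simp
  also have "\<dots> \<le> exp (D * (T - s)) * v T 0 * fact (l1 y)"
    using assms l1_minus_commute[of 0 y] by (intro mult_right_mono v_path_lower) auto
  also have "\<dots> \<le> exp (D * T) * v T 0 * fact (l1 y)"
    using assms D_pos v_nonneg by (intro mult_right_mono) auto
  finally show ?thesis using assms by (simp add: field_simps)
qed

text \<open>Summation by parts on a ball. The pairs inside the ball cancel by symmetry of the neighbour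
relation; what remains are the edges that leave the ball, and each contributes at most \<open>K\<close>.\<close>
lemma sum_neighbours_cutoff:
  fixes g w :: "int ^ 'd \<Rightarrow> real"
  assumes g: "\<And>z. 0 \<le> g z" and w: "\<And>z. 0 \<le> w z"
    and bnd: "\<And>z y. l1 z = m \<Longrightarrow> l1 y = Suc m \<Longrightarrow> g z * w y \<le> K" and K: "0 \<le> K"
  shows "(\<Sum>z\<in>l1_ball m. g z * (\<Sum>y\<in>nearest_neighbours z. w y))
       \<le> (\<Sum>z\<in>l1_ball m. w z * (\<Sum>y\<in>nearest_neighbours z. g y))
          + (1 + D) ^ m * D * K" (is "?L \<le> ?R + _")
proof -
  let ?B = "l1_ball m :: (int ^ 'd) set" and ?N = "nearest_neighbours :: int ^ 'd \<Rightarrow> _"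
  have "?L = (\<Sum>z\<in>?B. (\<Sum>y\<in>?N z \<inter> ?B. g z * w y) + (\<Sum>y\<in>?N z - ?B. g z * w y))"
    by (intro sum.cong refl) (simp add: sum.Int_Diff[of "?N _" _ ?B] distrib_left sum_distrib_left)
  also have "\<dots> = (\<Sum>z\<in>?B. \<Sum>y\<in>?N z \<inter> ?B. g z * w y) + (\<Sum>z\<in>?B. \<Sum>y\<in>?N z - ?B. g z * w y)"
    by (rule sum.distrib)
  also have "(\<Sum>z\<in>?B. \<Sum>y\<in>?N z \<inter> ?B. g z * w y) = (\<Sum>z\<in>?B. \<Sum>y\<in>?B. if y \<in> ?N z then g z * w y else 0)"
    by (rule sum.cong[OF refl]) (subst Int_commute, rule sum.inter_restrict[of ?B _ "?N _"], simp)
  also have "\<dots> = (\<Sum>y\<in>?B. \<Sum>z\<in>?B. if y \<in> ?N z then g z * w y else 0)"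
    by (rule sum.swap)
  also have "\<dots> = (\<Sum>y\<in>?B. \<Sum>z\<in>?N y \<inter> ?B. g z * w y)"
  proof (rule sum.cong[OF refl])
    fix y
    have "(\<Sum>z\<in>?B. if y \<in> ?N z then g z * w y else 0) = (\<Sum>z\<in>?B. if z \<in> ?N y then g z * w y else 0)"
      by (simp only: nearest_neighbours_sym[of y])
    also have "\<dots> = (\<Sum>z\<in>?B \<inter> ?N y. g z * w y)" by (rule sum.inter_restrict[symmetric]) simp
    finally show "(\<Sum>z\<in>?B. if y \<in> ?N z then g z * w y else 0) = (\<Sum>z\<in>?N y \<inter> ?B. g z * w y)"
      by (simp only: Int_commute)
  qed
  also have "\<dots> \<le> ?R"
    unfolding sum_distrib_left using g w
    by (intro sum_mono order.trans[OF _ sum_mono2[of "?N _" "?N _ \<inter> ?B"]]) (auto simp: mult.commute)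
  also have "(\<Sum>z\<in>?B. \<Sum>y\<in>?N z - ?B. g z * w y) \<le> (\<Sum>z\<in>?B. \<Sum>y\<in>?N z. K)"
  proof (intro sum_mono)
    fix z assume z: "z \<in> ?B"
    have "(\<Sum>y\<in>?N z - ?B. g z * w y) \<le> (\<Sum>y\<in>?N z - ?B. K)"
    proof (intro sum_mono bnd)
      fix y assume "y \<in> ?N z - ?B"
      then show "l1 z = m" "l1 y = Suc m"
        using z l1_nearest_neighbours[of y z] by (auto simp: l1_ball_def)
    qed
    also have "\<dots> \<le> (\<Sum>y\<in>?N z. K)" using K by (intro sum_mono2) auto
    finally show "(\<Sum>y\<in>?N z - ?B. g z * w y) \<le> (\<Sum>y\<in>?N z. K)" .
  qed
  also have "\<dots> = real (card ?B) * (D * K)"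
    by (simp add: card_nearest_neighbours D_def)
  also have "\<dots> \<le> (1 + D) ^ m * (D * K)"
  proof (intro mult_right_mono)
    have "real (card ?B) \<le> real ((1 + 2 * CARD('d)) ^ m)"
      using card_l1_ball by (rule of_nat_mono)
    then show "real (card ?B) \<le> (1 + D) ^ m" by (simp add: D_def)
  qed (use K D_pos in auto)
  finally show ?thesis by (simp add: mult.assoc)
qed

text \<open>Duality: the pairing \<open>\<Sum>z. v s z * supersol A B k (t - s) z\<close> over a ball does not increase in \<open>s\<close>,
up to the flow across the boundary of the ball. At \<open>s = t\<close> it is at least the mass of the ball of
radius \<open>k\<close>, and at \<open>s = 0\<close> it only sees the supersolution at the origin.\<close>
lemma mass_upper_cutoff:
  assumes t: "0 < t" "t < T" and AB: "0 \<le> A" "0 \<le> B"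
    and V_le: "\<And>z. V z \<le> A + B * real (l1 z)"
  defines "x \<equiv> D * t * exp (B * t)"
  shows "(\<Sum>z\<in>l1_ball k. v t z) \<le> exp (A * t) * exp x
     + t * ((1 + D) ^ (k + j) * D * (exp ((A + B * real (k + j)) * t) * (x ^ j / fact j * exp x)
              * (v T 0 * exp (D * T) * fact (Suc (k + j)) / (T - t) ^ Suc (k + j))))"
proof -
  define m where "m = k + j"
  define K where "K = exp ((A + B * real m) * t) * (x ^ j / fact j * exp x)
              * (v T 0 * exp (D * T) * fact (Suc m) / (T - t) ^ Suc m)"
  define e where "e = (1 + D) ^ m * D * K"
  let ?B = "l1_ball m :: (int ^ 'd) set"
  let ?g = "supersol A B k"
  let ?G = "\<lambda>s. (\<Sum>z\<in>?B. v s z * ?g (t - s) z)"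
  have x: "0 \<le> x" using t D_pos by (simp add: x_def)
  have K: "0 \<le> K" using x t v_nonneg[of T 0] by (simp add: K_def)
  have bnd: "?g (t - s) z * v s y \<le> K" if s: "0 \<le> s" "s \<le> t" and z: "l1 z = m" and y: "l1 y = Suc m" for s z y
  proof -
    let ?x = "D * (t - s) * exp (B * (t - s))"
    have x': "0 \<le> ?x" "?x \<le> x"
      using s t D_pos AB by (auto simp: x_def intro!: mult_mono mult_nonneg_nonneg)
    have "exp ((A + B * real m) * (t - s)) \<le> exp ((A + B * real m) * t)"
      using s AB by (simp add: mult_left_mono)
    moreover have "exp_tail j ?x \<le> x ^ j / fact j * exp x"
      using exp_tail_mono[OF x'] exp_tail_upper[OF x] by (rule order_trans)
    ultimately have "?g (t - s) z \<le> exp ((A + B * real m) * t) * (x ^ j / fact j * exp x)"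
      unfolding supersol_def z using exp_tail_nonneg[OF x'(1)] by (intro mult_mono) (auto simp: m_def)
    moreover have "v s y \<le> v T 0 * exp (D * T) * fact (Suc m) / (T - t) ^ Suc m"
      using v_growth[OF s t(2), of y] by (simp add: y)
    ultimately show ?thesis
      unfolding K_def using v_nonneg[OF s(1)] supersol_nonneg s x by (intro mult_mono) auto
  qed
  have "e * 0 - ?G 0 \<le> e * t - ?G t"
  proof (rule DERIV_nonneg_imp_increasing_open[of 0 t "\<lambda>s. e * s - ?G s"])
    fix s assume s: "0 < s" "s < t"
    have "\<exists>g'. \<forall>z. ((\<lambda>s. ?g s z) has_real_derivative g' z) (at (t - s)) \<and>
            V z * ?g (t - s) z + (\<Sum>y\<in>nearest_neighbours z. ?g (t - s) y) \<le> g' z"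
      by (rule choice) (use supersol_deriv[OF _ AB V_le, of "t - s"] s in \<open>metis diff_ge_0_iff_ge less_imp_le\<close>)
    then obtain g' where g': "\<And>z. ((\<lambda>s. ?g s z) has_real_derivative g' z) (at (t - s))"
      "\<And>z. V z * ?g (t - s) z + (\<Sum>y\<in>nearest_neighbours z. ?g (t - s) y) \<le> g' z" by blast
    have g'': "((\<lambda>s. ?g (t - s) z) has_real_derivative - g' z) (at s)" for z
    proof -
      have "((\<lambda>s. t - s) has_real_derivative - 1) (at s)" by (auto intro!: derivative_eq_intros)
      from DERIV_chain2[where f = "\<lambda>s. ?g s z", OF g'(1)[of z] this] show ?thesis by simp
    qed
    define N where "N z = (\<Sum>y\<in>nearest_neighbours z. v s y)" for z
    have "(?G has_real_derivative
        (\<Sum>z\<in>?B. (N z - D * v s z + V z * v s z) * ?g (t - s) z + v s z * - g' z)) (at s)"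
      using s by (auto intro!: derivative_eq_intros v_deriv g'' simp: N_def mult.commute)
    moreover have "(\<Sum>z\<in>?B. (N z - D * v s z + V z * v s z) * ?g (t - s) z + v s z * - g' z) \<le> e"
    proof -
      have "(\<Sum>z\<in>?B. (N z - D * v s z + V z * v s z) * ?g (t - s) z + v s z * - g' z)
          \<le> (\<Sum>z\<in>?B. ?g (t - s) z * N z - v s z * (\<Sum>y\<in>nearest_neighbours z. ?g (t - s) y))"
      proof (intro sum_mono)
        fix z
        have vs: "0 \<le> v s z" "0 \<le> D * v s z * ?g (t - s) z"
          using s v_nonneg D_pos supersol_nonneg by auto
        show "(N z - D * v s z + V z * v s z) * ?g (t - s) z + v s z * - g' z
          \<le> ?g (t - s) z * N z - v s z * (\<Sum>y\<in>nearest_neighbours z. ?g (t - s) y)"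
          using mult_left_mono[OF g'(2)[of z] vs(1)] vs(2) by (simp add: algebra_simps)
      qed
      also have "\<dots> \<le> e"
        unfolding sum_subtractf N_def e_def
        using sum_neighbours_cutoff[of "?g (t - s)" "v s" m K] supersol_nonneg v_nonneg s bnd K by auto
      finally show ?thesis .
    qed
    ultimately obtain G' where G': "(?G has_real_derivative G') (at s)" "G' \<le> e" by blast
    have "((\<lambda>s. e * s - ?G s) has_real_derivative e * 1 - G') (at s)"
      by (intro DERIV_diff DERIV_cmult DERIV_ident G')
    then show "\<exists>y. ((\<lambda>s. e * s - ?G s) has_real_derivative y) (at s) \<and> 0 \<le> y"
      using G'(2) by (intro exI[of _ "e - G'"]) simp
  next
    have "continuous_on {0..t} (\<lambda>s. ?g (t - s) z)" for z
    proof -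
      have "continuous_on {0..t} (exp_tail l \<circ> (\<lambda>s. D * (t - s) * exp (B * (t - s))))" for l
        unfolding comp_def exp_tail_def by (intro continuous_intros) auto
      then show ?thesis unfolding supersol_def comp_def by (intro continuous_intros)
    qed
    then show "continuous_on {0..t} (\<lambda>s. e * s - ?G s)"
      by (intro continuous_intros v_continuous) auto
  qed (use t in auto)
  then have "?G t \<le> ?G 0 + t * e" by (simp add: mult.commute)
  moreover have "?G 0 = exp (A * t) * exp x"
  proof -
    have "?G 0 = (\<Sum>z\<in>?B. if z = 0 then ?g t z else 0)"
      by (intro sum.cong refl) (simp add: v_0)
    also have "\<dots> = ?g t 0"
      by (subst sum.delta[OF finite_l1_ball]) (simp add: l1_ball_def)
    finally show ?thesis by (simp add: supersol_def x_def)
  qed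
  moreover have "(\<Sum>z\<in>l1_ball k. v t z) \<le> ?G t"
  proof -
    have "(\<Sum>z\<in>l1_ball k. v t z) = (\<Sum>z\<in>l1_ball k. v t z * ?g (t - t) z)"
      by (intro sum.cong refl) (simp add: supersol_start l1_ball_def)
    also have "\<dots> \<le> ?G t"
      using t v_nonneg[of t] supersol_nonneg[of 0]
      by (intro sum_mono2[OF finite_l1_ball]) (auto simp: l1_ball_def m_def)
    finally show ?thesis .
  qed
  ultimately show ?thesis by (simp add: e_def K_def m_def)
qed

text \<open>As the cutoff radius \<open>k + j\<close> grows, the supersolution decays like \<open>1 / fact j\<close> while the solution
may grow like \<open>fact (k + j + 1)\<close>. The factorials cancel up to a factor that is exponential in \<open>j\<close>, and
a large time horizon \<open>T\<close> in the growth bound turns the remaining geometric factor into a null sequence.\<close>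
lemma mass_upper_ball:
  assumes t: "0 < t" and AB: "0 \<le> A" "0 \<le> B"
    and V_le: "\<And>z. V z \<le> A + B * real (l1 z)"
  shows "(\<Sum>z\<in>l1_ball k. v t z) \<le> exp (A * t + D * t * exp (B * t))"
proof -
  define x where "x = D * t * exp (B * t)"
  have x: "0 < x" using t D_pos by (simp add: x_def)
  define c where "c = 2 * (1 + D) * exp (B * t) * x"
  have c: "0 < c" using x D_pos by (simp add: c_def)
  \<comment> \<open>With this horizon the ratio \<open>c / (T - t)\<close> of the geometric error term is \<open>1 / 2\<close>.\<close>
  define T where "T = t + 2 * c"
  have T: "t < T" "T - t = 2 * c" using c by (simp_all add: T_def)
  define C where "C = t * ((1 + D) ^ k * D * (exp ((A + B * real k) * t) * exp x
              * (v T 0 * exp (D * T) * (2 ^ (k + 1) * fact (k + 1)) / (T - t) ^ (k + 1))))"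
  have bound: "(\<Sum>z\<in>l1_ball k. v t z) \<le> exp (A * t) * exp x + C * (1 / 2) ^ j" for j
  proof -
    have "fact (Suc (k + j)) = fact (k + 1) * fact j * real (Suc (k + j) choose (k + 1))"
      using binomial_fact_lemma[of "k + 1" "Suc (k + j)"]
      by (metis Suc_eq_plus1 add_Suc add_diff_cancel_left' le_add1 of_nat_fact of_nat_mult)
    also have "\<dots> \<le> fact (k + 1) * fact j * 2 ^ Suc (k + j)"
      using of_nat_mono[OF binomial_le_pow2[of "Suc (k + j)" "k + 1"], where ?'a = real]
      by (intro mult_left_mono) (simp_all del: fact_Suc binomial_Suc_Suc power_Suc)
    also have "\<dots> = (2 ^ (k + 1) * fact (k + 1)) * 2 ^ j * (fact j :: real)"
      by (simp add: power_add mult_ac del: fact_Suc)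
    finally have F: "fact (Suc (k + j)) / fact j \<le> (2 ^ (k + 1) * fact (k + 1)) * (2 :: real) ^ j"
      by (simp add: divide_simps del: fact_Suc)
    let ?P = "t * (1 + D) ^ (k + j) * D * exp ((A + B * real (k + j)) * t) * x ^ j * exp x
        * v T 0 * exp (D * T) / (T - t) ^ Suc (k + j)"
    have P: "0 \<le> ?P" using t T x D_pos v_nonneg[of T 0] by auto
    have "(\<Sum>z\<in>l1_ball k. v t z) \<le> exp (A * t) * exp x + ?P * (fact (Suc (k + j)) / fact j)"
      using mass_upper_cutoff[OF t T(1) AB V_le, of k j]
      by (simp add: x_def mult_ac del: fact_Suc)
    also have "?P * (fact (Suc (k + j)) / fact j) \<le> ?P * ((2 ^ (k + 1) * fact (k + 1)) * 2 ^ j)"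
      by (rule mult_left_mono[OF F P])
    also have "\<dots> = C * (c / (T - t)) ^ j"
    proof -
      have "exp ((A + B * real (k + j)) * t) = exp ((A + B * real k) * t) * exp (B * t) ^ j"
        by (simp add: exp_of_nat_mult[symmetric] exp_add[symmetric] algebra_simps)
      then show ?thesis
        unfolding C_def c_def power_add power_mult_distrib power_divide power_Suc
        by (simp add: mult_ac del: fact_Suc)
    qed
    also have "c / (T - t) = 1 / 2" using T c by simp
    finally show ?thesis by simp
  qed
  have "(\<lambda>j. exp (A * t) * exp x + C * (1 / 2) ^ j) \<longlonglongrightarrow> exp (A * t) * exp x + C * 0"
    by (intro tendsto_intros LIMSEQ_power_zero) simp
  then have "(\<Sum>z\<in>l1_ball k. v t z) \<le> exp (A * t) * exp x + C * 0"
    by (rule LIMSEQ_le_const) (use bound in auto)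
  then show ?thesis by (simp add: x_def exp_add)
qed

lemma
  assumes t: "0 < t" and AB: "0 \<le> A" "0 \<le> B"
    and V_le: "\<And>z. V z \<le> A + B * real (l1 z)"
  shows v_summable: "v t summable_on UNIV"
    and total_mass_upper: "total_mass v t \<le> exp (A * t + D * t * exp (B * t))"
proof -
  have fin: "sum (v t) S \<le> exp (A * t + D * t * exp (B * t))" if "finite S" for S
  proof -
    obtain k where "S \<subseteq> l1_ball k" using finite_subset_l1_ball[OF \<open>finite S\<close>] .
    then have "sum (v t) S \<le> (\<Sum>z\<in>l1_ball k. v t z)"
      using t v_nonneg by (intro sum_mono2) auto
    also note mass_upper_ball[OF assms]
    finally show ?thesis .
  qed
  show "v t summable_on UNIV"
    by (rule nonneg_bdd_above_summable_on)
       (use t v_nonneg fin in \<open>auto simp: bdd_above_def intro!: exI[of _ "exp (A * t + D * t * exp (B * t))"]\<close>)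
  then show "total_mass v t \<le> exp (A * t + D * t * exp (B * t))"
    unfolding total_mass_def by (rule infsum_le_finite_sums) (use fin in auto)
qed

lemma total_mass_lower:
  assumes t: "0 < t" and AB: "0 \<le> A" "0 \<le> B"
    and V_le: "\<And>z. V z \<le> A + B * real (l1 z)"
    and z: "0 < V z" "real (l1 z) \<le> t * V z"
  shows "exp (t * V z - real (l1 z) * ln (V z) - real (l1 z) - D * t) \<le> total_mass v t"
proof -
  have "v t z = infsum (v t) {z}" by simp
  also have "\<dots> \<le> total_mass v t"
    unfolding total_mass_def using v_summable[OF t AB V_le] t v_nonneg
    by (intro infsum_mono_neutral) auto
  finally show ?thesis using v_lower[OF z] by simp
qed

end

section \<open>Sums of negative powers over the lattice\<close>

definition gamma_kernel :: "real \<Rightarrow> real \<Rightarrow> real \<Rightarrow> real" where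
  "gamma_kernel b c s = indicator {0<..} s * s powr (b - 1) * exp (- (c * s))"

lemma gamma_kernel_nonneg: "0 \<le> gamma_kernel b c s"
  by (simp add: gamma_kernel_def)

lemma gamma_kernel_measurable [measurable]: "gamma_kernel b c \<in> borel_measurable borel"
  unfolding gamma_kernel_def[abs_def] by measurable

lemma nn_integral_gamma_kernel:
  assumes "0 < b" "0 < c"
  shows "(\<integral>\<^sup>+s. ennreal (gamma_kernel b c s) \<partial>lborel) = ennreal (Gamma b * c powr (- b))"
proof -
  have "ennreal (Gamma b) = (\<integral>\<^sup>+t. ennreal (indicator {0..} t * t powr (b - 1) / exp t) \<partial>lborel)"
    using assms by (intro Gamma_conv_nn_integral_real)
  also have "\<dots> = ennreal \<bar>c\<bar> * (\<integral>\<^sup>+s. ennreal (indicator {0..} (0 + c * s) * (0 + c * s) powr (b - 1)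
      / exp (0 + c * s)) \<partial>lborel)"
    by (rule nn_integral_real_affine) (use assms in \<open>auto\<close>)
  also have "\<dots> = ennreal c * (\<integral>\<^sup>+s. ennreal (c powr (b - 1)) * ennreal (gamma_kernel b c s) \<partial>lborel)"
    using assms
    by (intro arg_cong2[where f = "(*)"] nn_integral_cong)
       (auto simp: gamma_kernel_def indicator_def powr_mult exp_minus divide_inverse
          ennreal_mult[symmetric] zero_le_mult_iff)
  also have "\<dots> = ennreal (c * c powr (b - 1)) * (\<integral>\<^sup>+s. ennreal (gamma_kernel b c s) \<partial>lborel)"
    using assms by (subst nn_integral_cmult) (auto simp: ennreal_mult mult.assoc)
  also have "c * c powr (b - 1) = c powr b"
    using assms by (simp add: powr_mult_base)
  finally have "ennreal (c powr (- b)) * ennreal (Gamma b)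
      = ennreal (c powr (- b)) * (ennreal (c powr b) * (\<integral>\<^sup>+s. ennreal (gamma_kernel b c s) \<partial>lborel))"
    by simp
  also have "\<dots> = (\<integral>\<^sup>+s. ennreal (gamma_kernel b c s) \<partial>lborel)"
  proof -
    have "ennreal (c powr (- b)) * ennreal (c powr b) = 1"
      using assms by (subst ennreal_mult'[symmetric]) (simp_all add: powr_minus)
    then show ?thesis by (simp only: mult.assoc[symmetric] mult_1_left)
  qed
  finally have "(\<integral>\<^sup>+s. ennreal (gamma_kernel b c s) \<partial>lborel) = ennreal (c powr (- b)) * ennreal (Gamma b)"
    by (rule sym)
  also have "\<dots> = ennreal (c powr (- b) * Gamma b)"
    by (rule ennreal_mult[symmetric]) (use Gamma_real_pos[OF assms(1)] in \<open>simp_all add: less_imp_le\<close>)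
  also have "c powr (- b) * Gamma b = Gamma b * c powr (- b)" by (rule mult.commute)
  finally show ?thesis .
qed

lemma nn_integral_count_space_has_sum:
  fixes f :: "'b \<Rightarrow> real"
  assumes "(f has_sum S) A" "\<And>x. x \<in> A \<Longrightarrow> 0 \<le> f x"
  shows "(\<integral>\<^sup>+x. ennreal (f x) \<partial>count_space A) = ennreal S"
proof -
  have "f summable_on A" using assms(1) by (rule has_sum_imp_summable)
  then have "Infinite_Sum.abs_summable_on f A" by (rule summable_on_iff_abs_summable_on_real[THEN iffD1])
  then have "Infinite_Set_Sum.abs_summable_on f A" by (rule abs_summable_equivalent[THEN iffD1])
  then show ?thesis
    using assms by (simp add: nn_integral_conv_infsetsum infsetsum_infsum infsumI)
qed

lemma has_sum_count_space_nn_integral: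
  fixes f :: "'b \<Rightarrow> real"
  assumes "(\<integral>\<^sup>+x. ennreal (f x) \<partial>count_space A) = ennreal S" "\<And>x. 0 \<le> f x" "0 \<le> S"
  shows "(f has_sum S) A"
proof -
  have "has_bochner_integral (count_space A) f S"
    by (rule has_bochner_integral_nn_integral) (use assms in auto)
  then have "Infinite_Set_Sum.abs_summable_on f A" "infsetsum f A = S"
    unfolding abs_summable_on_def infsetsum_def
    by (simp_all add: has_bochner_integral_iff)
  moreover then have "f summable_on A"
    using abs_summable_equivalent abs_summable_summable by blast
  ultimately show ?thesis by (metis has_sum_infsum infsetsum_infsum)
qed

text \<open>Written as \<open>coth (l / 2)\<close>, the two-sided geometric series with ratio \<open>exp (- l)\<close>. Both
elementary bounds below agree with \<open>2 / l\<close> to leading order as \<open>l\<close> tends to \<open>0\<close>.\<close>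
definition coth_half :: "real \<Rightarrow> real" where
  "coth_half l = (1 + exp (- l)) / (1 - exp (- l))"

lemma has_sum_exp_int:
  assumes "0 < l"
  shows "((\<lambda>k :: int. exp (- (l * \<bar>real_of_int k\<bar>))) has_sum coth_half l) UNIV"
proof -
  define x where "x = exp (- l)"
  have x: "0 < x" "x < 1" using assms by (auto simp: x_def)
  have pow: "exp (- (l * real n)) = x ^ n" for n
    by (simp add: x_def exp_of_nat_mult[symmetric] mult.commute)
  have geo: "((\<lambda>n :: nat. x ^ n) has_sum 1 / (1 - x)) UNIV"
    using x by (intro sums_nonneg_imp_has_sum geometric_sums) auto
  have "((\<lambda>k :: int. exp (- (l * \<bar>real_of_int k\<bar>))) has_sum 1 / (1 - x)) (range int)"
    using geo by (subst has_sum_reindex) (auto simp: inj_on_def comp_def pow)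
  moreover have "((\<lambda>k :: int. exp (- (l * \<bar>real_of_int k\<bar>))) has_sum x * (1 / (1 - x)))
       (range (\<lambda>n. - int (Suc n)))"
  proof (subst has_sum_reindex)
    have "exp (- (l * \<bar>real_of_int (- int (Suc n))\<bar>)) = x * x ^ n" for n
      using pow[of "Suc n"] by (simp add: add.commute)
    then show "((\<lambda>k :: int. exp (- (l * \<bar>real_of_int k\<bar>))) \<circ> (\<lambda>n. - int (Suc n)) has_sum x * (1 / (1 - x))) UNIV"
      using has_sum_cmult_right[OF geo, of x] by (simp add: comp_def)
  qed (auto simp: inj_on_def)
  ultimately have "((\<lambda>k :: int. exp (- (l * \<bar>real_of_int k\<bar>))) has_sum 1 / (1 - x) + x * (1 / (1 - x)))
       (range int \<union> range (\<lambda>n. - int (Suc n)))"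
    by (rule has_sum_Un_disjoint) auto
  also have "range int \<union> range (\<lambda>n. - int (Suc n)) = UNIV"
  proof (intro equalityI subsetI)
    fix k :: int
    show "k \<in> range int \<union> range (\<lambda>n. - int (Suc n))"
      by (cases k rule: int_cases) blast+
  qed simp
  also have "1 / (1 - x) + x * (1 / (1 - x)) = coth_half l"
    by (simp add: coth_half_def x_def add_divide_distrib)
  finally show ?thesis .
qed

lemma coth_half_lower: "2 / l \<le> coth_half l" if "0 < l"
proof -
  have "(2 + l) * exp (- l) + l - 2 \<ge> 0"
  proof -
    have "(2 + 0) * exp (- 0) + 0 - 2 \<le> (2 + l) * exp (- l) + l - 2"
    proof (rule DERIV_nonneg_imp_nondecreasing[of 0 l])
      fix x :: real assume "0 \<le> x"
      have "((\<lambda>x. (2 + x) * exp (- x) + x - 2) has_real_derivative (1 - (1 + x) * exp (- x))) (at x)"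
        by (auto intro!: derivative_eq_intros simp: algebra_simps)
      moreover have "(1 + x) * exp (- x) \<le> exp x * exp (- x)"
        by (intro mult_right_mono exp_ge_add_one_self) simp
      ultimately show "\<exists>y. ((\<lambda>x. (2 + x) * exp (- x) + x - 2) has_real_derivative y) (at x) \<and> 0 \<le> y"
        by (intro exI[of _ "1 - (1 + x) * exp (- x)"]) (simp add: exp_minus_inverse)
    qed (use that in auto)
    then show ?thesis by simp
  qed
  moreover have "exp (- l) < 1" using that by simp
  ultimately show ?thesis using that by (simp add: coth_half_def field_simps)
qed

lemma coth_half_upper: "coth_half l \<le> 1 + 2 / l" if "0 < l"
proof -
  have "(1 + l) * exp (- l) \<le> exp l * exp (- l)"
    by (intro mult_right_mono exp_ge_add_one_self) simp
  then have "(1 + l) * exp (- l) \<le> 1" by (simp add: exp_minus_inverse)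
  moreover have "exp (- l) < 1" using that by simp
  ultimately show ?thesis using that by (simp add: coth_half_def field_simps)
qed

lemma nn_integral_lattice_exp:
  assumes "0 < l"
  shows "(\<integral>\<^sup>+z. ennreal (exp (- (l * real (l1 z)))) \<partial>count_space (UNIV :: (int ^ 'd) set))
      = ennreal (coth_half l ^ CARD('d))"
proof -
  interpret product_sigma_finite "\<lambda>_ :: 'd. count_space (UNIV :: int set)"
    by (intro product_sigma_finite.intro sigma_finite_measure_count_space_countable) auto
  have "bij_betw vec_lambda (PiE UNIV (\<lambda>_ :: 'd. UNIV :: int set)) UNIV"
    by (rule bij_betwI[where g = vec_nth]) (auto simp: vec_lambda_inverse vec_nth_inverse)
  then have "(\<integral>\<^sup>+z. ennreal (exp (- (l * real (l1 z)))) \<partial>count_space (UNIV :: (int ^ 'd) set))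
      = (\<integral>\<^sup>+f. ennreal (exp (- (l * real (l1 (vec_lambda f))))) \<partial>count_space (PiE UNIV (\<lambda>_ :: 'd. UNIV :: int set)))"
    by (rule nn_integral_bij_count_space[symmetric])
  also have "count_space (PiE UNIV (\<lambda>_ :: 'd. UNIV :: int set)) = PiM UNIV (\<lambda>_. count_space UNIV)"
    by (rule count_space_PiM_finite[symmetric]) auto
  also have "(\<integral>\<^sup>+f. ennreal (exp (- (l * real (l1 (vec_lambda f))))) \<partial>PiM UNIV (\<lambda>_ :: 'd. count_space (UNIV :: int set)))
      = (\<integral>\<^sup>+f. (\<Prod>i\<in>UNIV. ennreal (exp (- (l * \<bar>real_of_int (f i)\<bar>)))) \<partial>PiM UNIV (\<lambda>_ :: 'd. count_space (UNIV :: int set)))"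
    by (intro nn_integral_cong)
       (simp add: prod_ennreal exp_sum[symmetric] real_l1 sum_distrib_left sum_negf)
  also have "\<dots> = (\<Prod>i\<in>(UNIV :: 'd set). \<integral>\<^sup>+k. ennreal (exp (- (l * \<bar>real_of_int k\<bar>))) \<partial>count_space UNIV)"
    by (rule product_nn_integral_prod) auto
  also have "\<dots> = (\<Prod>i\<in>(UNIV :: 'd set). ennreal (coth_half l))"
    by (subst nn_integral_count_space_has_sum[OF has_sum_exp_int[OF assms]]) auto
  also have "\<dots> = ennreal (coth_half l ^ CARD('d))"
  proof -
    have "0 \<le> coth_half l" using assms by (intro order_trans[OF _ coth_half_lower]) auto
    then show ?thesis by (simp add: ennreal_power)
  qed
  finally show ?thesis .
qed

text \<open>A negative power is a mixture of exponentials, by the Gamma integral, and exponentials of the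
\<open>l1\<close> norm factorise over the coordinates. This turns the sum over the lattice into a
one-dimensional integral.\<close>
lemma nn_integral_lattice_powr:
  assumes "0 < b" "0 < y" "0 < c"
  shows "(\<integral>\<^sup>+z. ennreal (Gamma b * (y + c * real (l1 z)) powr (- b)) \<partial>count_space (UNIV :: (int ^ 'd) set))
      = (\<integral>\<^sup>+s. ennreal (gamma_kernel b y s * coth_half (c * s) ^ CARD('d)) \<partial>lborel)"
proof -
  have "(\<integral>\<^sup>+z. ennreal (Gamma b * (y + c * real (l1 z)) powr (- b)) \<partial>count_space (UNIV :: (int ^ 'd) set))
      = (\<integral>\<^sup>+z. (\<integral>\<^sup>+s. ennreal (gamma_kernel b (y + c * real (l1 z)) s) \<partial>lborel) \<partial>count_space (UNIV :: (int ^ 'd) set))"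
    using assms by (intro nn_integral_cong nn_integral_gamma_kernel[symmetric]) (auto intro: add_pos_nonneg)
  also have "\<dots> = (\<integral>\<^sup>+s. (\<integral>\<^sup>+z. ennreal (gamma_kernel b (y + c * real (l1 z)) s) \<partial>count_space (UNIV :: (int ^ 'd) set)) \<partial>lborel)"
    by (rule nn_integral_count_space_nn_integral[symmetric]) auto
  also have "\<dots> = (\<integral>\<^sup>+s. ennreal (gamma_kernel b y s * coth_half (c * s) ^ CARD('d)) \<partial>lborel)"
  proof (intro nn_integral_cong)
    fix s :: real
    show "(\<integral>\<^sup>+z. ennreal (gamma_kernel b (y + c * real (l1 z)) s) \<partial>count_space (UNIV :: (int ^ 'd) set))
       = ennreal (gamma_kernel b y s * coth_half (c * s) ^ CARD('d))"
    proof (cases "0 < s")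
      case True
      have "(\<integral>\<^sup>+z. ennreal (gamma_kernel b (y + c * real (l1 z)) s) \<partial>count_space (UNIV :: (int ^ 'd) set))
        = (\<integral>\<^sup>+z. ennreal (gamma_kernel b y s) * ennreal (exp (- (c * s * real (l1 z)))) \<partial>count_space (UNIV :: (int ^ 'd) set))"
        by (intro nn_integral_cong)
           (simp add: gamma_kernel_def ennreal_mult'[symmetric] exp_add[symmetric] algebra_simps)
      also have "\<dots> = ennreal (gamma_kernel b y s) * ennreal (coth_half (c * s) ^ CARD('d))"
        using True assms by (subst nn_integral_cmult) (simp_all add: nn_integral_lattice_exp)
      also have "\<dots> = ennreal (gamma_kernel b y s * coth_half (c * s) ^ CARD('d))"
        by (simp add: ennreal_mult' gamma_kernel_nonneg)
      finally show ?thesis .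
    qed (simp add: gamma_kernel_def)
  qed
  finally show ?thesis .
qed

lemma gamma_kernel_divide_power:
  assumes "0 < s"
  shows "gamma_kernel b y s * (1 / s) ^ j = gamma_kernel (b - real j) y s"
proof -
  have "s powr (b - 1) * (1 / s) ^ j = s powr (b - real j - 1)"
    using assms by (simp add: powr_diff powr_realpow power_divide divide_simps)
  then show ?thesis using assms by (simp add: gamma_kernel_def mult_ac)
qed

text \<open>The value of the integral of \<open>(y + q * \<bar>x\<bar>) powr (- b)\<close> over \<open>d\<close>-dimensional space, with \<open>\<bar>x\<bar>\<close> the
\<open>l1\<close> norm.\<close>
definition lattice_sum_limit :: "nat \<Rightarrow> real \<Rightarrow> real \<Rightarrow> real \<Rightarrow> real" where
  "lattice_sum_limit d b q y = (2 / q) ^ d * Gamma (b - real d) / Gamma b * y powr (real d - b)"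

text \<open>Inserting the two bounds on \<open>coth_half\<close> into the one-dimensional integral gives Gamma integrals
again. The lower bound is already the limit, for every \<open>r\<close>. The upper bound is a binomial sum,
of which only the term with \<open>j = d\<close> survives as \<open>r\<close> tends to infinity.\<close>
lemma lattice_sum:
  fixes b q y :: real
  assumes b: "real CARD('d) < b" and pos: "0 < y" "0 < q"
  shows lattice_summable: "\<And>r. 0 < r \<Longrightarrow>
           (\<lambda>z :: int ^ 'd. (y + q * real (l1 z) / r) powr (- b)) summable_on UNIV"
    and lattice_sum_tendsto:
      "((\<lambda>r. (\<Sum>\<^sub>\<infinity>z :: int ^ 'd. (y + q * real (l1 z) / r) powr (- b)) / r ^ CARD('d))
          \<longlongrightarrow> lattice_sum_limit CARD('d) b q y) at_top"
proof -
  let ?d = "CARD('d)"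
  define c where "c j = real (?d choose j) * (2 / q) ^ j * (Gamma (b - real j) * y powr (- (b - real j)))" for j
  define U where "U r = (\<Sum>j\<le>?d. c j * (1 / r) ^ (?d - j))" for r
  let ?f = "\<lambda>r z. (y + q * real (l1 z) / r) powr (- b)"
  define I where "I r = (\<integral>\<^sup>+z. ennreal (Gamma b * ?f r z) \<partial>count_space (UNIV :: (int ^ 'd) set))" for r
  have Gpos: "0 < Gamma b" using b by (intro Gamma_real_pos) linarith
  have bj: "0 < b - real j" if "j \<le> ?d" for j using that b by linarith
  have c_nonneg: "0 \<le> c j" if "j \<le> ?d" for j
    using bj[OF that] pos Gamma_real_pos[of "b - real j"] by (simp add: c_def)
  have I: "I r = (\<integral>\<^sup>+s. ennreal (gamma_kernel b y s * coth_half (q / r * s) ^ ?d) \<partial>lborel)" if "0 < r" for r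
    unfolding I_def using nn_integral_lattice_powr[of b y "q / r", where ?'d = 'd] b pos that by simp
  have lower: "ennreal (r ^ ?d * c ?d) \<le> I r" if r: "0 < r" for r
  proof -
    have "ennreal (r ^ ?d * c ?d) = ennreal (r ^ ?d * (2 / q) ^ ?d) * ennreal (Gamma (b - real ?d) * y powr (- (b - real ?d)))"
      using r pos by (subst ennreal_mult'[symmetric]) (auto simp: c_def mult_ac)
    also have "\<dots> = (\<integral>\<^sup>+s. ennreal (r ^ ?d * (2 / q) ^ ?d) * ennreal (gamma_kernel (b - real ?d) y s) \<partial>lborel)"
      using bj[of ?d] pos by (subst nn_integral_cmult) (simp_all add: nn_integral_gamma_kernel)
    also have "\<dots> \<le> I r"
      unfolding I[OF r]
    proof (intro nn_integral_mono)
      fix s :: real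
      show "ennreal (r ^ ?d * (2 / q) ^ ?d) * ennreal (gamma_kernel (b - real ?d) y s)
         \<le> ennreal (gamma_kernel b y s * coth_half (q / r * s) ^ ?d)"
      proof (cases "0 < s")
        case True
        have "r ^ ?d * (2 / q) ^ ?d * gamma_kernel (b - real ?d) y s
            = gamma_kernel b y s * (2 / (q / r * s)) ^ ?d"
          unfolding gamma_kernel_divide_power[OF True, symmetric]
          by (simp add: power_mult_distrib power_divide field_simps)
        also have "\<dots> \<le> gamma_kernel b y s * coth_half (q / r * s) ^ ?d"
          using True pos r by (intro mult_left_mono power_mono coth_half_lower gamma_kernel_nonneg) auto
        finally show ?thesis using r pos
          by (subst ennreal_mult'[symmetric]) (auto intro!: ennreal_leI)
      qed (simp add: gamma_kernel_def)
    qed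
    finally show ?thesis .
  qed
  have upper: "I r \<le> ennreal (r ^ ?d * U r)" if r: "0 < r" for r
  proof -
    have "I r \<le> (\<integral>\<^sup>+s. (\<Sum>j\<le>?d. ennreal (r ^ ?d * (real (?d choose j) * (2 / q) ^ j * (1 / r) ^ (?d - j))) * ennreal (gamma_kernel (b - real j) y s)) \<partial>lborel)"
      unfolding I[OF r]
    proof (intro nn_integral_mono)
      fix s :: real
      show "ennreal (gamma_kernel b y s * coth_half (q / r * s) ^ ?d)
        \<le> (\<Sum>j\<le>?d. ennreal (r ^ ?d * (real (?d choose j) * (2 / q) ^ j * (1 / r) ^ (?d - j))) * ennreal (gamma_kernel (b - real j) y s))"
      proof (cases "0 < s")
        case True
        have "0 \<le> coth_half (q / r * s)"
          using coth_half_lower[of "q / r * s"] True pos r by (intro order_trans[OF _ coth_half_lower]) auto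
        then have "coth_half (q / r * s) ^ ?d \<le> (1 + 2 / (q / r * s)) ^ ?d"
          using True pos r by (intro power_mono coth_half_upper) auto
        also have "1 + 2 / (q / r * s) = r * (2 / q * (1 / s) + 1 / r)"
          using True pos r by (simp add: field_simps)
        also have "\<dots> ^ ?d = (\<Sum>j\<le>?d. r ^ ?d * (real (?d choose j) * (2 / q) ^ j * (1 / r) ^ (?d - j)) * (1 / s) ^ j)"
          unfolding power_mult_distrib binomial_ring sum_distrib_left
          by (intro sum.cong) (simp_all add: mult_ac)
        finally have "gamma_kernel b y s * coth_half (q / r * s) ^ ?d
           \<le> gamma_kernel b y s * (\<Sum>j\<le>?d. r ^ ?d * (real (?d choose j) * (2 / q) ^ j * (1 / r) ^ (?d - j)) * (1 / s) ^ j)"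
          by (rule mult_left_mono) (rule gamma_kernel_nonneg)
        also have "\<dots> = (\<Sum>j\<le>?d. r ^ ?d * (real (?d choose j) * (2 / q) ^ j * (1 / r) ^ (?d - j)) * gamma_kernel (b - real j) y s)"
          unfolding gamma_kernel_divide_power[OF True, symmetric] sum_distrib_left
          by (intro sum.cong) (simp_all add: mult_ac)
        finally show ?thesis using r pos
          by (simp add: ennreal_mult'[symmetric] sum_ennreal gamma_kernel_nonneg ennreal_leI)
      qed (simp add: gamma_kernel_def)
    qed
    also have "\<dots> = (\<Sum>j\<le>?d. ennreal (r ^ ?d * (real (?d choose j) * (2 / q) ^ j * (1 / r) ^ (?d - j))) * ennreal (Gamma (b - real j) * y powr (- (b - real j))))"
      using bj pos by (subst nn_integral_sum) (auto simp: nn_integral_cmult nn_integral_gamma_kernel)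
    also have "\<dots> = (\<Sum>j\<le>?d. ennreal (r ^ ?d * (c j * (1 / r) ^ (?d - j))))"
      using r pos by (intro sum.cong refl) (subst ennreal_mult'[symmetric], auto simp: c_def mult_ac)
    also have "\<dots> = ennreal (r ^ ?d * U r)"
      unfolding U_def sum_distrib_left using r c_nonneg by (intro sum_ennreal) auto
    finally show ?thesis .
  qed
  have ex: "\<exists>J. ((\<lambda>z :: int ^ 'd. Gamma b * ?f r z) has_sum J) UNIV \<and> r ^ ?d * c ?d \<le> J \<and> J \<le> r ^ ?d * U r"
    if r: "0 < r" for r
  proof -
    have U: "0 \<le> r ^ ?d * U r" using r c_nonneg by (auto simp: U_def intro!: mult_nonneg_nonneg sum_nonneg)
    have "I r < \<infinity>" using upper[OF r] by (rule le_less_trans) simp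
    then obtain J where J: "0 \<le> J" "I r = ennreal J" by (cases "I r") auto
    have "((\<lambda>z :: int ^ 'd. Gamma b * ?f r z) has_sum J) UNIV"
      using J Gpos unfolding I_def by (intro has_sum_count_space_nn_integral) auto
    then show ?thesis using lower[OF r] upper[OF r] J U
      by (auto simp: ennreal_le_iff)
  qed
  have ex': "(?f r :: int ^ 'd \<Rightarrow> real) summable_on UNIV"
      "c ?d / Gamma b \<le> (\<Sum>\<^sub>\<infinity>z :: int ^ 'd. ?f r z) / r ^ ?d"
      "(\<Sum>\<^sub>\<infinity>z :: int ^ 'd. ?f r z) / r ^ ?d \<le> U r / Gamma b" if r: "0 < r" for r
  proof -
    obtain J where J: "((\<lambda>z :: int ^ 'd. Gamma b * ?f r z) has_sum J) UNIV" "r ^ ?d * c ?d \<le> J" "J \<le> r ^ ?d * U r"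
      using ex[OF r] by blast
    have "((\<lambda>z :: int ^ 'd. inverse (Gamma b) * (Gamma b * ?f r z)) has_sum inverse (Gamma b) * J) UNIV"
      by (rule has_sum_cmult_right[OF J(1)])
    then have S: "((\<lambda>z :: int ^ 'd. ?f r z) has_sum J / Gamma b) UNIV"
      using Gpos by (simp add: field_simps)
    then show "(?f r :: int ^ 'd \<Rightarrow> real) summable_on UNIV" by (rule has_sum_imp_summable)
    show "c ?d / Gamma b \<le> (\<Sum>\<^sub>\<infinity>z :: int ^ 'd. ?f r z) / r ^ ?d"
      "(\<Sum>\<^sub>\<infinity>z :: int ^ 'd. ?f r z) / r ^ ?d \<le> U r / Gamma b"
      unfolding infsumI[OF S] using J(2,3) r Gpos by (simp_all add: field_simps)
  qed
  from ex'(1) show "\<And>r. 0 < r \<Longrightarrow>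
           (\<lambda>z :: int ^ 'd. (y + q * real (l1 z) / r) powr (- b)) summable_on UNIV" .
  have lim: "c ?d / Gamma b = lattice_sum_limit ?d b q y"
    by (simp add: c_def lattice_sum_limit_def)
  have "(U \<longlongrightarrow> (\<Sum>j\<le>?d. c j * (if j = ?d then 1 else 0))) at_top"
    unfolding U_def
  proof (intro tendsto_sum tendsto_mult tendsto_const)
    fix j assume "j \<in> {..?d}"
    have "((\<lambda>r :: real. (1 / r) ^ (?d - j)) \<longlongrightarrow> 0 ^ (?d - j)) at_top"
      by (intro tendsto_power) real_asymp
    then show "((\<lambda>r :: real. (1 / r) ^ (?d - j)) \<longlongrightarrow> (if j = ?d then 1 else 0)) at_top"
      using \<open>j \<in> _\<close> by (cases "j = ?d") (auto simp: power_0_left)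
  qed
  also have "(\<Sum>j\<le>?d. c j * (if j = ?d then 1 else 0)) = c ?d"
    by (simp add: if_distrib[of "\<lambda>x. _ * x"] cong: if_cong)
  finally have "((\<lambda>r. U r / Gamma b) \<longlongrightarrow> c ?d / Gamma b) at_top"
    using Gpos by (intro tendsto_divide tendsto_const) auto
  then show "((\<lambda>r. (\<Sum>\<^sub>\<infinity>z :: int ^ 'd. ?f r z) / r ^ ?d) \<longlongrightarrow> lattice_sum_limit ?d b q y) at_top"
    unfolding lim[symmetric]
  proof (rule tendsto_sandwich[OF _ _ tendsto_const, rotated 2])
    show "\<forall>\<^sub>F r in at_top. c ?d / Gamma b \<le> (\<Sum>\<^sub>\<infinity>z :: int ^ 'd. ?f r z) / r ^ ?d"
      using eventually_gt_at_top[of 0] by eventually_elim (rule ex'(2))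
    show "\<forall>\<^sub>F r in at_top. (\<Sum>\<^sub>\<infinity>z :: int ^ 'd. ?f r z) / r ^ ?d \<le> U r / Gamma b"
      using eventually_gt_at_top[of 0] by eventually_elim (rule ex'(3))
  qed
qed

section \<open>Independent Pareto potentials\<close>

locale pareto_field = prob_space M for M :: "'a measure" +
  fixes \<xi> :: "int ^ 'd \<Rightarrow> 'a \<Rightarrow> real" and \<alpha> :: real
  assumes alpha: "real CARD('d) < \<alpha>"
    and indep: "indep_vars (\<lambda>_. borel) \<xi> UNIV"
    and pareto: "\<And>z x. prob {\<omega> \<in> space M. \<xi> z \<omega> \<le> x} = (if x < 1 then 0 else 1 - x powr (- \<alpha>))"
begin

lemma alpha_pos: "0 < \<alpha>"
  using alpha by (rule le_less_trans[rotated]) simp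

lemma measurable_xi [measurable]: "\<xi> z \<in> borel_measurable M"
  using indep by (auto simp: indep_vars_def)

lemma AE_xi_pos: "AE \<omega> in M. \<forall>z. 0 < \<xi> z \<omega>"
proof (subst AE_all_countable, intro allI)
  fix z
  have "{\<omega> \<in> space M. \<xi> z \<omega> \<le> 0} \<in> events" "prob {\<omega> \<in> space M. \<xi> z \<omega> \<le> 0} = 0"
    using pareto[of z 0] by simp_all
  then have "AE \<omega> in M. \<omega> \<notin> {\<omega> \<in> space M. \<xi> z \<omega> \<le> 0}"
    by (simp add: prob_eq_0)
  then show "AE \<omega> in M. 0 < \<xi> z \<omega>" using AE_space by eventually_elim auto
qed

lemma prob_finite_below:
  assumes F: "finite F" and h: "\<And>z. z \<in> F \<Longrightarrow> 1 \<le> h z"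
  shows "prob {\<omega> \<in> space M. \<forall>z\<in>F. \<xi> z \<omega> \<le> h z} = (\<Prod>z\<in>F. 1 - h z powr (- \<alpha>))"
proof (cases "F = {}")
  case False
  have "indep_sets (\<lambda>z. {\<xi> z -` A \<inter> space M | A. A \<in> sets borel}) UNIV"
    using indep by (simp add: indep_vars_def2)
  then have "prob (\<Inter>z\<in>F. \<xi> z -` {..h z} \<inter> space M) = (\<Prod>z\<in>F. prob (\<xi> z -` {..h z} \<inter> space M))"
  proof (rule indep_setsD[OF _ subset_UNIV False F])
    show "\<forall>z\<in>F. \<xi> z -` {..h z} \<inter> space M \<in> {\<xi> z -` A \<inter> space M | A. A \<in> sets borel}"
      using atMost_borel by blast
  qed
  also have "(\<Inter>z\<in>F. \<xi> z -` {..h z} \<inter> space M) = {\<omega> \<in> space M. \<forall>z\<in>F. \<xi> z \<omega> \<le> h z}"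
    using False by auto
  also have "(\<Prod>z\<in>F. prob (\<xi> z -` {..h z} \<inter> space M)) = (\<Prod>z\<in>F. 1 - h z powr (- \<alpha>))"
  proof (rule prod.cong[OF refl])
    fix z assume "z \<in> F"
    have "\<xi> z -` {..h z} \<inter> space M = {\<omega> \<in> space M. \<xi> z \<omega> \<le> h z}" by auto
    then show "prob (\<xi> z -` {..h z} \<inter> space M) = 1 - h z powr (- \<alpha>)"
      using pareto[of z "h z"] h[OF \<open>z \<in> F\<close>] by simp
  qed
  finally show ?thesis .
qed (simp add: prob_space)

lemma prob_finite_below_upper:
  assumes F: "finite F" and h: "\<And>z. z \<in> F \<Longrightarrow> 1 \<le> h z"
  shows "prob {\<omega> \<in> space M. \<forall>z\<in>F. \<xi> z \<omega> \<le> h z} \<le> exp (- (\<Sum>z\<in>F. h z powr (- \<alpha>)))"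
proof -
  have "(\<Prod>z\<in>F. 1 - h z powr (- \<alpha>)) \<le> (\<Prod>z\<in>F. exp (- (h z powr (- \<alpha>))))"
  proof (intro prod_mono conjI)
    fix z assume "z \<in> F"
    have "h z powr (- \<alpha>) \<le> 1" using h[OF \<open>z \<in> F\<close>] alpha_pos by (simp add: powr_minus field_simps ge_one_powr_ge_zero)
    then show "0 \<le> 1 - h z powr (- \<alpha>)" by simp
    show "1 - h z powr (- \<alpha>) \<le> exp (- (h z powr (- \<alpha>)))"
      using exp_ge_add_one_self[of "- (h z powr (- \<alpha>))"] by simp
  qed
  then show ?thesis
    using F by (simp add: prob_finite_below[OF F h] exp_sum sum_negf[symmetric])
qed

text \<open>The inequality \<open>1 - p \<ge> exp (- p / (1 - p))\<close> makes the product bound uniform over finite sets of sites,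
so that it passes to the whole lattice by continuity of the measure.\<close>
lemma prob_all_below_lower:
  assumes h: "\<And>z. h0 \<le> h z" and h0: "1 < h0" and summable: "(\<lambda>z. h z powr (- \<alpha>)) summable_on UNIV"
  shows "exp (- (\<Sum>\<^sub>\<infinity>z. h z powr (- \<alpha>)) / (1 - h0 powr (- \<alpha>)))
      \<le> prob {\<omega> \<in> space M. \<forall>z. \<xi> z \<omega> \<le> h z}" (is "?L \<le> _")
proof -
  define p where "p z = h z powr (- \<alpha>)" for z
  define p0 where "p0 = h0 powr (- \<alpha>)"
  have p0: "p0 < 1" using h0 alpha_pos by (simp add: p0_def powr_minus field_simps less_powr_iff)
  have p: "0 \<le> p z" "p z \<le> p0" for z
    using h[of z] h0 alpha_pos by (auto simp: p_def p0_def intro: powr_mono2')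
  have fin: "?L \<le> prob {\<omega> \<in> space M. \<forall>z\<in>l1_ball n. \<xi> z \<omega> \<le> h z}" for n
  proof -
    have "(\<Sum>z\<in>l1_ball n. p z) \<le> (\<Sum>\<^sub>\<infinity>z. p z)"
      using summable p by (intro finite_sum_le_infsum) (auto simp: p_def[abs_def])
    then have "?L \<le> exp (- (\<Sum>z\<in>l1_ball n. p z) / (1 - p0))"
      using p0 by (simp add: p_def[symmetric] p0_def[symmetric] divide_right_mono)
    also have "\<dots> = (\<Prod>z\<in>l1_ball n. exp (- (p z / (1 - p0))))"
      by (simp add: exp_sum sum_negf[symmetric] sum_divide_distrib)
    also have "\<dots> \<le> (\<Prod>z\<in>l1_ball n. 1 - p z)"
    proof (intro prod_mono conjI)
      fix z
      have "1 + p z / (1 - p z) \<le> exp (p z / (1 - p z))" by (rule exp_ge_add_one_self)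
      moreover have "p z / (1 - p z) \<le> p z / (1 - p0)"
        using p[of z] p0 by (intro divide_left_mono) auto
      moreover have "1 + p z / (1 - p z) = 1 / (1 - p z)"
        using p[of z] p0 by (simp add: field_simps)
      ultimately have "1 / (1 - p z) \<le> exp (p z / (1 - p0))"
        by (smt (verit) exp_le_cancel_iff)
      then show "exp (- (p z / (1 - p0))) \<le> 1 - p z"
        using p[of z] p0 by (simp add: exp_minus field_simps)
    qed simp
    also have "\<dots> = prob {\<omega> \<in> space M. \<forall>z\<in>l1_ball n. \<xi> z \<omega> \<le> h z}"
      unfolding p_def by (rule prob_finite_below[symmetric]) (use h h0 in \<open>auto intro: order_trans less_imp_le\<close>)
    finally show ?thesis .
  qed
  have "(\<lambda>n. prob {\<omega> \<in> space M. \<forall>z\<in>l1_ball n. \<xi> z \<omega> \<le> h z})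
     \<longlonglongrightarrow> prob (\<Inter>n. {\<omega> \<in> space M. \<forall>z\<in>l1_ball n. \<xi> z \<omega> \<le> h z})"
    by (rule finite_Lim_measure_decseq) (auto simp: decseq_def l1_ball_def)
  also have "(\<Inter>n. {\<omega> \<in> space M. \<forall>z\<in>l1_ball n. \<xi> z \<omega> \<le> h z}) = {\<omega> \<in> space M. \<forall>z. \<xi> z \<omega> \<le> h z}"
    by (auto simp: l1_ball_def)
  finally show ?thesis by (rule LIMSEQ_le_const) (use fin in auto)
qed

text \<open>This is where \<open>\<alpha> > d\<close> enters pathwise: the sum of \<open>(C + C * l1 z) powr (- \<alpha>)\<close> over the lattice
is finite, and by homogeneity it is \<open>C powr (- \<alpha>)\<close> times its value for \<open>C = 1\<close>, hence tends to \<open>0\<close>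
as \<open>C\<close> grows.\<close>
lemma AE_linear_growth: "AE \<omega> in M. \<exists>C::nat. \<forall>z. \<xi> z \<omega> \<le> real C + real C * real (l1 z)"
proof -
  define S where "S = (\<Sum>\<^sub>\<infinity>z :: int ^ 'd. (1 + 1 * real (l1 z) / 1) powr (- \<alpha>))"
  let ?A = "{\<omega> \<in> space M. \<exists>C::nat. \<forall>z. \<xi> z \<omega> \<le> real C + real C * real (l1 z)}"
  have bound: "exp (- (real C powr (- \<alpha>) * S) / (1 - real C powr (- \<alpha>))) \<le> prob ?A" if "1 < C" for C :: nat
  proof -
    have eq: "(real C + real C * real (l1 z)) powr (- \<alpha>)
        = real C powr (- \<alpha>) * (1 + 1 * real (l1 z) / 1) powr (- \<alpha>)" for z :: "int ^ 'd"
      by (subst powr_mult[symmetric]) (simp_all add: distrib_left)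
    have "(\<lambda>z :: int ^ 'd. (real C + real C * real (l1 z)) powr (- \<alpha>)) summable_on UNIV"
      unfolding eq by (intro summable_on_cmult_right lattice_summable alpha) auto
    then have "exp (- (\<Sum>\<^sub>\<infinity>z :: int ^ 'd. (real C + real C * real (l1 z)) powr (- \<alpha>)) / (1 - real C powr (- \<alpha>)))
      \<le> prob {\<omega> \<in> space M. \<forall>z. \<xi> z \<omega> \<le> real C + real C * real (l1 z)}"
      using that
      by (intro prob_all_below_lower[where h = "\<lambda>z. real C + real C * real (l1 z)" and ?h0.0 = "real C"]) auto
    also have "\<dots> \<le> prob ?A"
      by (intro finite_measure_mono) auto
    finally show ?thesis unfolding eq S_def by (simp add: infsum_cmult_right')
  qed
  have lim: "(\<lambda>C. real C powr (- \<alpha>)) \<longlonglongrightarrow> 0"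
    using alpha_pos by (intro tendsto_neg_powr filterlim_real_sequentially) auto
  have "(\<lambda>C. exp (- (real C powr (- \<alpha>) * S) / (1 - real C powr (- \<alpha>)))) \<longlonglongrightarrow> exp (- (0 * S) / (1 - 0))"
    by (intro tendsto_intros lim) auto
  then have "exp (- (0 * S) / (1 - 0)) \<le> prob ?A"
    by (rule LIMSEQ_le_const2) (use bound in \<open>auto intro!: exI[of _ 2]\<close>)
  then have "prob ?A = 1" by (intro antisym) simp_all
  then have "AE \<omega> in M. \<omega> \<in> ?A" by (subst (asm) prob_eq_1) auto
  then show ?thesis by eventually_elim blast
qed

end

text \<open>On the reals, summability is absolute summability, so the unordered sum agrees everywhere with the
integral with respect to counting measure: where the family is not summable, both take the
default value \<open>0\<close>. This covers the null set on which a solution may fail to be nonnegative.\<close>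
lemma borel_measurable_infsum:
  fixes f :: "'a \<Rightarrow> 'b :: countable \<Rightarrow> real"
  assumes "\<And>z. (\<lambda>\<omega>. f \<omega> z) \<in> borel_measurable M"
  shows "(\<lambda>\<omega>. \<Sum>\<^sub>\<infinity>z. f \<omega> z) \<in> borel_measurable M"
proof -
  interpret sigma_finite_measure "count_space (UNIV :: 'b set)"
    by (rule sigma_finite_measure_count_space)
  have "(\<Sum>\<^sub>\<infinity>z. f \<omega> z) = (\<integral>z. f \<omega> z \<partial>count_space UNIV)" for \<omega>
  proof (cases "f \<omega> summable_on UNIV")
    case True
    then have "Infinite_Set_Sum.abs_summable_on (f \<omega>) UNIV"
      using summable_on_iff_abs_summable_on_real abs_summable_equivalent by blast
    then show ?thesis by (simp add: infsetsum_infsum[symmetric] infsetsum_def)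
  next
    case False
    then have "\<not> integrable (count_space UNIV) (f \<omega>)"
      using summable_on_iff_abs_summable_on_real abs_summable_equivalent
      by (metis abs_summable_on_def)
    then show ?thesis using False by (simp add: infsum_not_exists not_integrable_integral_eq)
  qed
  moreover have "(\<lambda>\<omega>. \<integral>z. f \<omega> z \<partial>count_space UNIV) \<in> borel_measurable M"
  proof (rule borel_measurable_lebesgue_integral)
    have "(\<lambda>(z, \<omega>). f \<omega> z) \<in> borel_measurable (count_space (UNIV :: 'b set) \<Otimes>\<^sub>M M)"
      by (rule measurable_pair_measure_countable1) (use assms in auto)
    from measurable_compose[OF measurable_pair_swap' this]
    show "(\<lambda>(\<omega>, z). f \<omega> z) \<in> borel_measurable (M \<Otimes>\<^sub>M count_space UNIV)"
      by (simp add: case_prod_beta')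
  qed
  ultimately show ?thesis by simp
qed

lemma theta_eq_lattice_sum_limit:
  assumes "real d < \<alpha>" "0 < d"
  shows "lattice_sum_limit d \<alpha> (real d / (\<alpha> - real d)) y = theta d \<alpha> * y powr (real d - \<alpha>)"
proof -
  have "Gamma (real d) = fact (d - 1)"
    using Gamma_fact[of "d - 1", where ?'a = real] assms by (simp add: of_nat_diff)
  moreover have "(2 / (real d / (\<alpha> - real d))) ^ d = (\<alpha> - real d) ^ d * 2 ^ d / real d ^ d"
    by (simp only: divide_divide_eq_right power_mult_distrib power_divide mult.commute)
  moreover have "Gamma \<alpha> \<noteq> 0"
  proof -
    have "0 < \<alpha>" using assms by (intro le_less_trans[OF of_nat_0_le_iff[of d]])
    then have "0 < Gamma \<alpha>" by (rule Gamma_real_pos)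
    then show ?thesis by (rule less_imp_neq[THEN not_sym])
  qed
  ultimately show ?thesis
    by (simp add: lattice_sum_limit_def theta_def Beta_def mult_ac)
qed

lemma theta_pos:
  assumes "real d < \<alpha>" "0 < d"
  shows "0 < theta d \<alpha>"
  using assms Gamma_real_pos[of "\<alpha> - real d"] Gamma_real_pos[of "real d"] Gamma_real_pos[of \<alpha>]
  by (auto simp: theta_def Beta_def intro!: divide_pos_pos mult_pos_pos)

section \<open>The relevant scales and the logarithm of the total mass\<close>

text \<open>
The size of the largest potential values that matter at time \<open>t\<close>, and the distance at which they are
found. They are tied together by two relations: \<open>a * t = r * ln t\<close>, so that the gain from the
potential balances the cost of travelling, and \<open>a powr \<alpha> = r ^ d\<close>, so that a ball of
radius \<open>r\<close> contains, on average, a bounded number of values of order \<open>a\<close>.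
\<close>
definition scale_a :: "real \<Rightarrow> real \<Rightarrow> real" where
  "scale_a q t = (t / ln t) powr q"

definition scale_r :: "real \<Rightarrow> real \<Rightarrow> real" where
  "scale_r q t = scale_a q t * (t / ln t)"

lemma scale_pos: "1 < t \<Longrightarrow> 0 < scale_a q t" "1 < t \<Longrightarrow> 0 < scale_r q t"
  by (auto simp: scale_a_def scale_r_def)

lemma scale_a_times: "1 < t \<Longrightarrow> scale_a q t * t = scale_r q t * ln t"
  by (simp add: scale_r_def)

lemma scale_a_powr_eq:
  assumes "1 < t" "real d < \<alpha>"
  shows "scale_a (real d / (\<alpha> - real d)) t powr \<alpha> = scale_r (real d / (\<alpha> - real d)) t ^ d"
proof -
  define q where "q = real d / (\<alpha> - real d)"
  have q: "q * \<alpha> = (q + 1) * real d" using assms by (simp add: q_def field_simps)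
  have pos: "0 < t / ln t" using assms by simp
  have r_eq: "scale_r q t = (t / ln t) powr (q + 1)"
    unfolding scale_r_def scale_a_def powr_add using pos by (simp only: powr_one)
  have "scale_r q t ^ d = (t / ln t) powr ((q + 1) * real d)"
    unfolding r_eq using pos by (subst powr_power) (auto simp: mult.commute)
  then show ?thesis
    by (simp only: q_def[symmetric] q[symmetric] scale_a_def powr_powr)
qed

lemma scale_r_at_top: "0 < q \<Longrightarrow> filterlim (scale_r q) at_top at_top"
  unfolding scale_r_def scale_a_def by real_asymp

lemma scale_a_at_top: "0 < q \<Longrightarrow> filterlim (scale_a q) at_top at_top"
  unfolding scale_a_def by real_asymp

lemma eventually_scale_upper:
  assumes "0 < q" "0 < k" "k < 1" "0 < y"
  shows "\<forall>\<^sub>F t in at_top. D * t powr (k * q) \<le> (1 - k) * scale_a q t * y"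
proof -
  have "k * q < q" using assms by simp
  then have "((\<lambda>t. t powr (k * q) / scale_a q t) \<longlongrightarrow> 0) at_top"
    unfolding scale_a_def using assms(1) by real_asymp
  then have "((\<lambda>t. D * (t powr (k * q) / scale_a q t)) \<longlongrightarrow> D * 0) at_top"
    by (intro tendsto_intros)
  then have "\<forall>\<^sub>F t in at_top. D * (t powr (k * q) / scale_a q t) < (1 - k) * y"
    using assms by (intro order_tendstoD) auto
  then show ?thesis
    using eventually_gt_at_top[of 1]
  proof eventually_elim
    case (elim t)
    then show ?case using scale_pos(1)[of t q] by (simp add: field_simps)
  qed
qed

lemma eventually_scale_lower:
  assumes "0 < q" "1 < k" "0 < y"
  shows "\<forall>\<^sub>F t in at_top. ln (k * scale_a q t * (y + q * ln t)) + 1 \<le> k * q * ln t"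
proof -
  have "q < k * q" using assms by simp
  then have "((\<lambda>t. scale_a q t * (y + q * ln t) / t powr (k * q)) \<longlongrightarrow> 0) at_top"
    unfolding scale_a_def using assms(1) by real_asymp
  then have "((\<lambda>t. exp 1 * k * (scale_a q t * (y + q * ln t) / t powr (k * q))) \<longlongrightarrow> exp 1 * k * 0) at_top"
    by (intro tendsto_intros)
  then have "\<forall>\<^sub>F t in at_top. exp 1 * k * (scale_a q t * (y + q * ln t) / t powr (k * q)) < 1"
    by (intro order_tendstoD) auto
  then show ?thesis
    using eventually_gt_at_top[of 1]
  proof eventually_elim
    case (elim t)
    let ?x = "k * scale_a q t * (y + q * ln t)"
    have x: "0 < ?x" using elim(2) scale_pos(1)[of t q] assms by (auto intro!: mult_pos_pos add_pos_pos)
    have "ln ?x + 1 = ln (?x * exp 1)" using ln_mult_pos[OF x exp_gt_zero[of 1]] by (simp only: ln_exp)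
    also have "\<dots> \<le> ln (t powr (k * q))"
    proof (rule ln_mono)
      show "?x * exp 1 \<le> t powr (k * q)" using elim(1,2) by (simp add: field_simps)
      show "0 < ?x * exp 1" using x by (rule mult_pos_pos) simp
    qed
    also have "\<dots> = k * q * ln t" using elim by (simp add: ln_powr)
    finally show ?case .
  qed
qed

context pam
begin

text \<open>The bound on the potential is of the form \<open>A + B * l1 z\<close>, with \<open>A\<close> below the target \<open>a * y\<close> by the
factor \<open>k\<close>, which leaves room for the second summand. The slope is chosen such that \<open>exp (B * t)\<close> in the general upper bound is the power
\<open>t powr (k * q)\<close>, which is of lower order than \<open>a\<close> as soon as \<open>k < 1\<close>.\<close>
lemma ln_total_mass_upper:
  assumes t: "1 < t" and a: "0 < a" and r: "0 < r" and ar: "a * t = r * ln t"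
    and k: "0 < k" and y: "0 < y" and q: "0 \<le> q"
    and V_le: "\<And>z. V z \<le> k * a * (y + q * real (l1 z) / r)"
    and small: "D * t powr (k * q) \<le> (1 - k) * a * y"
  shows "ln (total_mass v t) \<le> t * (a * y)"
proof -
  define A where "A = k * a * y"
  define B where "B = k * a * q / r"
  have "B * t = k * q * ln t" using r ar by (simp add: B_def field_simps)
  then have expB: "exp (B * t) = t powr (k * q)" using t by (simp add: powr_def)
  have "total_mass v t \<le> exp (A * t + D * t * exp (B * t))"
  proof (rule total_mass_upper)
    show "V z \<le> A + B * real (l1 z)" for z
      using V_le[of z] by (simp add: A_def B_def algebra_simps)
  qed (use t a r k y q in \<open>auto simp: A_def B_def\<close>)
  also have "A * t + D * t * exp (B * t) \<le> t * (a * y)"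
    using mult_left_mono[OF small, of t] t by (simp add: expB A_def algebra_simps)
  finally have le: "total_mass v t \<le> exp (t * (a * y))" by simp
  have "0 \<le> total_mass v t"
    unfolding total_mass_def using t v_nonneg by (intro infsum_nonneg) auto
  then consider "total_mass v t = 0" | "0 < total_mass v t" by linarith
  then show ?thesis
  proof cases
    case 2
    then have "ln (total_mass v t) \<le> ln (exp (t * (a * y)))" using le by (intro ln_mono) auto
    then show ?thesis by simp
  qed (use t a y in simp)
qed

text \<open>A single site above the cone that is slightly too high forces the growth rate up. The function
\<open>x \<mapsto> t * x - n * ln x\<close> increases for \<open>x \<ge> n / t\<close>, so the value of the potential may be replaced by
the height \<open>h\<close> of the cone; the factor \<open>k > 1\<close> in the slope pays for the logarithm of \<open>h\<close>, which is
asymptotically at most \<open>q * ln t\<close> as long as the site is within distance \<open>r * ln t\<close>.\<close>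
lemma ln_total_mass_lower:
  assumes t: "1 < t" and a: "0 < a" and r: "0 < r" and ar: "a * t = r * ln t"
    and k: "0 < k" and y: "0 < y" and q: "0 \<le> q"
    and C: "0 \<le> C" "\<And>z. V z \<le> C + C * real (l1 z)"
    and z: "real (l1 z) \<le> r * ln t" "k * a * (y + q * real (l1 z) / r) < V z"
    and large1: "1 \<le> k * q * ln t"
    and large2: "ln (k * a * (y + q * ln t)) + 1 \<le> k * q * ln t"
    and large3: "D < (k - 1) * a * y"
  shows "t * (a * y) < ln (total_mass v t)"
proof -
  define n where "n = real (l1 z)"
  define h where "h = k * a * (y + q * n / r)"
  have n: "0 \<le> n" by (simp add: n_def)
  have pos: "0 < y + q * n / r" using n y q r by (intro add_pos_nonneg) auto
  then have h: "0 < h" "h < V z" using z k a by (simp_all add: h_def n_def)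
  have th: "t * h = k * (t * (a * y)) + n * (k * q * ln t)"
  proof -
    have "t * h = k * (t * (a * y)) + k * q * n * (a * t) / r"
      by (simp add: h_def algebra_simps)
    then show ?thesis using r by (simp add: ar)
  qed
  have "n * 1 \<le> n * (k * q * ln t)" using n large1 by (rule mult_left_mono[rotated])
  moreover have "0 \<le> k * (t * (a * y))" using t k a y by simp
  ultimately have nth: "n \<le> t * h" using th by simp
  have h_le: "h \<le> k * a * (y + q * ln t)"
  proof -
    have "n / r \<le> ln t" using z(1) r by (simp add: n_def field_simps)
    then have "q * (n / r) \<le> q * ln t" using q by (rule mult_left_mono)
    then show ?thesis unfolding h_def using k a by (intro mult_left_mono) auto
  qed
  have "ln h + 1 \<le> k * q * ln t" using large2 ln_mono[OF h_le h(1)] by linarith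
  then have n_ln_h: "n * (ln h + 1) \<le> n * (k * q * ln t)" using n by (rule mult_left_mono)
  have "ln (V z / h) \<le> V z / h - 1" using h by (intro ln_le_minus_one) auto
  then have "n * ln (V z / h) \<le> n * (V z / h - 1)" using n by (rule mult_left_mono)
  also have "\<dots> = n / h * (V z - h)" using h by (simp add: field_simps)
  also have "\<dots> \<le> t * (V z - h)"
    using nth h by (intro mult_right_mono) (auto simp: field_simps)
  finally have "n * ln (V z) \<le> n * ln h + t * (V z - h)" using h by (simp add: ln_div algebra_simps)
  then have "t * h - n * (ln h + 1) - D * t \<le> t * V z - n * ln (V z) - n - D * t"
    by (simp add: algebra_simps)
  moreover have "t * (a * y) < t * h - n * (ln h + 1) - D * t"
  proof -
    have "t * D < t * ((k - 1) * a * y)" using large3 t by simp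
    then show ?thesis using n_ln_h th by (simp add: algebra_simps)
  qed
  ultimately have less: "t * (a * y) < t * V z - n * ln (V z) - n - D * t" by linarith
  have "n \<le> t * V z" using nth h t by (smt (verit) mult_left_mono)
  then have "exp (t * V z - n * ln (V z) - n - D * t) \<le> total_mass v t"
    unfolding n_def using t h C by (intro total_mass_lower) auto
  then have "t * V z - n * ln (V z) - n - D * t \<le> ln (total_mass v t)"
    by (subst ln_ge_iff) (auto intro: less_le_trans[OF exp_gt_zero])
  with less show ?thesis by linarith
qed

end

text \<open>Far away from the origin the part \<open>\<alpha> - \<beta>\<close> of the exponent can be spent on a small factor, while the
remaining exponent \<open>\<beta> > d\<close> still gives a convergent sum. Hence the restriction to sites within distance
\<open>r * R\<close> costs nothing in the limit when \<open>R\<close> tends to infinity.\<close>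
lemma truncated_lattice_sum:
  fixes y q \<alpha> \<beta> R :: real
  assumes ab: "real CARD('d) < \<beta>" "\<beta> < \<alpha>" and pos: "0 < y" "0 < q" "0 < r" "0 \<le> R"
  shows "(\<Sum>\<^sub>\<infinity>z :: int ^ 'd. (y + q * real (l1 z) / r) powr (- \<alpha>))
     - (y + q * R) powr (\<beta> - \<alpha>) * (\<Sum>\<^sub>\<infinity>z :: int ^ 'd. (y + q * real (l1 z) / r) powr (- \<beta>))
     \<le> (\<Sum>z\<in>{z :: int ^ 'd. real (l1 z) \<le> r * R}. (y + q * real (l1 z) / r) powr (- \<alpha>))"
proof -
  let ?F = "{z :: int ^ 'd. real (l1 z) \<le> r * R}"
  let ?f = "\<lambda>b z :: int ^ 'd. (y + q * real (l1 z) / r) powr (- b)"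
  let ?c = "(y + q * R) powr (\<beta> - \<alpha>)"
  have F: "finite ?F" by (rule finite_l1_le)
  have sum: "(?f b) summable_on UNIV" if "b \<in> {\<alpha>, \<beta>}" for b
    using that ab pos by (intro lattice_summable) auto
  have ind: "((\<lambda>z. if z \<in> ?F then ?f \<alpha> z else 0) has_sum sum (?f \<alpha>) ?F) UNIV"
    by (rule has_sum_cong_neutral[THEN iffD1, OF _ _ _ has_sum_finite[OF F]]) auto
  have "(\<Sum>\<^sub>\<infinity>z. ?f \<alpha> z) \<le> sum (?f \<alpha>) ?F + ?c * (\<Sum>\<^sub>\<infinity>z. ?f \<beta> z)"
  proof (rule has_sum_mono[OF has_sum_infsum[OF sum] has_sum_add[OF ind has_sum_cmult_right[OF has_sum_infsum[OF sum]]]])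
    fix z :: "int ^ 'd"
    show "?f \<alpha> z \<le> (if z \<in> ?F then ?f \<alpha> z else 0) + ?c * ?f \<beta> z"
    proof (cases "z \<in> ?F")
      case False
      then have "R \<le> real (l1 z) / r" using pos by (simp add: field_simps)
      then have "y + q * R \<le> y + q * (real (l1 z) / r)" using pos by (intro add_left_mono mult_left_mono) auto
      moreover have "0 < y + q * R" using pos by (intro add_pos_nonneg) auto
      ultimately have "(y + q * real (l1 z) / r) powr (\<beta> - \<alpha>) \<le> ?c"
        using ab by (intro powr_mono2') auto
      then have "(y + q * real (l1 z) / r) powr (\<beta> - \<alpha>) * ?f \<beta> z \<le> ?c * ?f \<beta> z"
        by (rule mult_right_mono) simp
      then show ?thesis using False by (simp add: powr_add[symmetric])
    qed simp
  qed auto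
  then show ?thesis by simp
qed

section \<open>Convergence in law\<close>

locale pam_pareto = pareto_field M \<xi> \<alpha>
  for M :: "'a measure" and \<xi> :: "int ^ 'd \<Rightarrow> 'a \<Rightarrow> real" and \<alpha> :: real +
  fixes u :: "'a \<Rightarrow> real \<Rightarrow> int ^ 'd \<Rightarrow> real"
  assumes u_measurable: "\<And>t z. t \<ge> 0 \<Longrightarrow> (\<lambda>\<omega>. u \<omega> t z) \<in> borel_measurable M"
    and u_solution: "AE \<omega> in M. pam_nonneg_solution (\<lambda>z. \<xi> z \<omega>) (u \<omega>)"
begin

definition q :: real where "q = real CARD('d) / (\<alpha> - real CARD('d))"

definition growth_rate :: "real \<Rightarrow> 'a \<Rightarrow> real" where
  "growth_rate t \<omega> = (1 / t * ln (total_mass (u \<omega>) t)) * (t / ln t) powr (- q)"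

definition limit_exponent :: "real \<Rightarrow> real" where
  "limit_exponent y = theta CARD('d) \<alpha> * y powr (real CARD('d) - \<alpha>)"

definition scaled_sum :: "real \<Rightarrow> real \<Rightarrow> real \<Rightarrow> real" where
  "scaled_sum b y t = (\<Sum>\<^sub>\<infinity>z :: int ^ 'd. (y + q * real (l1 z) / scale_r q t) powr (- b)) / scale_r q t ^ CARD('d)"

lemma q_pos: "0 < q"
  using alpha by (simp add: q_def)

lemma growth_rate_measurable: "0 \<le> t \<Longrightarrow> growth_rate t \<in> borel_measurable M"
  unfolding growth_rate_def[abs_def] total_mass_def
  by (intro borel_measurable_times borel_measurable_const borel_measurable_ln
      borel_measurable_infsum u_measurable)

lemma growth_rate_le_iff: "1 < t \<Longrightarrow> growth_rate t \<omega> \<le> y \<longleftrightarrow> ln (total_mass (u \<omega>) t) \<le> t * (scale_a q t * y)"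
  using scale_pos(1)[of t q]
  by (simp add: growth_rate_def scale_a_def powr_minus field_simps)

lemma scaled_sum_tendsto:
  assumes "real CARD('d) < b" "0 < y"
  shows "((\<lambda>t. scaled_sum b y t) \<longlongrightarrow> lattice_sum_limit CARD('d) b q y) at_top"
  unfolding scaled_sum_def
  using filterlim_compose[OF lattice_sum_tendsto[OF assms q_pos] scale_r_at_top[OF q_pos]] .

lemma limit_exponent_eq: "limit_exponent y = lattice_sum_limit CARD('d) \<alpha> q y"
  unfolding q_def limit_exponent_def using theta_eq_lattice_sum_limit[of "CARD('d)" \<alpha> y] alpha by simp

lemma threshold_powr:
  assumes "1 < t" "0 < k" "0 < y"
  shows "(k * scale_a q t * (y + q * real (l1 z) / scale_r q t)) powr (- \<alpha>)
    = k powr (- \<alpha>) / scale_r q t ^ CARD('d) * (y + q * real (l1 z) / scale_r q t) powr (- \<alpha>)"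
proof -
  have "scale_a q t powr \<alpha> = scale_r q t ^ CARD('d)"
    unfolding q_def using assms(1) alpha by (rule scale_a_powr_eq)
  then have "scale_a q t powr (- \<alpha>) = 1 / scale_r q t ^ CARD('d)"
    by (simp add: powr_minus inverse_eq_divide)
  moreover have "0 < y + q * real (l1 z) / scale_r q t"
    using assms q_pos scale_pos(2)[of t q] by (intro add_pos_nonneg) auto
  ultimately show ?thesis
    using assms scale_pos(1)[of t q] by (simp add: powr_mult)
qed

text \<open>If the whole potential lies below the cone with factor \<open>k < 1\<close>, then the growth rate is at most \<open>y\<close>.\<close>
lemma prob_lower_bound:
  assumes k: "0 < k" "k < 1" and y: "0 < y"
  shows "\<forall>\<^sub>F t in at_top. exp (- (k powr (- \<alpha>) * scaled_sum \<alpha> y t) / (1 - (k * scale_a q t * y) powr (- \<alpha>)))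
      \<le> prob {\<omega> \<in> space M. growth_rate t \<omega> \<le> y}"
proof -
  have "\<forall>\<^sub>F t in at_top. 1 / (k * y) < scale_a q t"
    using scale_a_at_top[OF q_pos] by (simp add: filterlim_at_top_dense)
  with eventually_scale_upper[OF q_pos k y, of "2 * real CARD('d)"] eventually_gt_at_top[of 1]
  show ?thesis
  proof eventually_elim
    case (elim t)
    let ?r = "scale_r q t" and ?a = "scale_a q t"
    define h where "h z = k * ?a * (y + q * real (l1 z) / ?r)" for z :: "int ^ 'd"
    note pos = scale_pos[OF elim(2), of q]
    have h_powr: "h z powr (- \<alpha>) = k powr (- \<alpha>) / ?r ^ CARD('d) * (y + q * real (l1 z) / ?r) powr (- \<alpha>)" for z
      unfolding h_def by (rule threshold_powr[OF elim(2) k(1) y])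
    have sum_eq: "(\<Sum>\<^sub>\<infinity>z. h z powr (- \<alpha>)) = k powr (- \<alpha>) * scaled_sum \<alpha> y t"
      unfolding h_powr infsum_cmult_right' scaled_sum_def by simp
    have "exp (- (\<Sum>\<^sub>\<infinity>z. h z powr (- \<alpha>)) / (1 - (k * ?a * y) powr (- \<alpha>)))
        \<le> prob {\<omega> \<in> space M. \<forall>z. \<xi> z \<omega> \<le> h z}"
    proof (rule prob_all_below_lower)
      show "k * ?a * y \<le> h z" for z
        unfolding h_def using k y pos q_pos by (intro mult_left_mono) auto
      show "1 < k * ?a * y" using elim(3) k y by (simp add: field_simps)
      show "(\<lambda>z. h z powr (- \<alpha>)) summable_on UNIV"
        unfolding h_powr by (intro summable_on_cmult_right lattice_summable alpha y q_pos pos)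
    qed
    also have "prob {\<omega> \<in> space M. \<forall>z. \<xi> z \<omega> \<le> h z} \<le> prob {\<omega> \<in> space M. growth_rate t \<omega> \<le> y}"
    proof (rule finite_measure_mono_AE)
      show "AE \<omega> in M. \<omega> \<in> {\<omega> \<in> space M. \<forall>z. \<xi> z \<omega> \<le> h z} \<longrightarrow> \<omega> \<in> {\<omega> \<in> space M. growth_rate t \<omega> \<le> y}"
        using u_solution AE_xi_pos
      proof eventually_elim
        case (elim \<omega>)
        interpret pam "\<lambda>z. \<xi> z \<omega>" "u \<omega>"
          by unfold_locales (use elim in \<open>auto intro: less_imp_le\<close>)
        show ?case
          using ln_total_mass_upper[OF \<open>1 < t\<close> pos scale_a_times[OF \<open>1 < t\<close>] k(1) y, of q]
            \<open>2 * real CARD('d) * t powr (k * q) \<le> _\<close> q_pos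
          by (auto simp: growth_rate_le_iff[OF \<open>1 < t\<close>] h_def D_def)
      qed
      have [measurable]: "growth_rate t \<in> borel_measurable M" using elim(2) by (intro growth_rate_measurable) simp
      show "{\<omega> \<in> space M. growth_rate t \<omega> \<le> y} \<in> events" by measurable
    qed
    finally show ?case unfolding sum_eq .
  qed
qed

text \<open>If the growth rate is at most \<open>y\<close>, then no site within distance \<open>r * ln t\<close> exceeds the cone with
factor \<open>k > 1\<close>. The exponent \<open>b\<close> only serves to estimate the sites beyond that distance.\<close>
lemma prob_upper_bound:
  assumes k: "1 < k" and y: "0 < y" and b: "real CARD('d) < b" "b < \<alpha>"
  shows "\<forall>\<^sub>F t in at_top. prob {\<omega> \<in> space M. growth_rate t \<omega> \<le> y}
      \<le> exp (- (k powr (- \<alpha>) * (scaled_sum \<alpha> y t - (y + q * ln t) powr (b - \<alpha>) * scaled_sum b y t)))"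
proof -
  have "\<forall>\<^sub>F t in at_top. max (1 / (k * y)) (2 * real CARD('d) / ((k - 1) * y)) < scale_a q t"
    using scale_a_at_top[OF q_pos] by (simp only: filterlim_at_top_dense)
  moreover have "\<forall>\<^sub>F t in at_top. 1 \<le> k * q * ln t"
    using k q_pos by real_asymp
  ultimately show ?thesis
    using eventually_scale_lower[OF q_pos k y] eventually_gt_at_top[of 1]
  proof eventually_elim
    case (elim t)
    let ?r = "scale_r q t" and ?a = "scale_a q t"
    define h where "h z = k * ?a * (y + q * real (l1 z) / ?r)" for z :: "int ^ 'd"
    define F where "F = {z :: int ^ 'd. real (l1 z) \<le> ?r * ln t}"
    note t = \<open>1 < t\<close> and pos = scale_pos[OF \<open>1 < t\<close>, of q]
    have k0: "0 < k" using k by simp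
    have F: "finite F"
      unfolding F_def by (rule finite_l1_le)
    have "prob {\<omega> \<in> space M. growth_rate t \<omega> \<le> y} \<le> prob {\<omega> \<in> space M. \<forall>z\<in>F. \<xi> z \<omega> \<le> h z}"
    proof (rule finite_measure_mono_AE)
      show "AE \<omega> in M. \<omega> \<in> {\<omega> \<in> space M. growth_rate t \<omega> \<le> y} \<longrightarrow> \<omega> \<in> {\<omega> \<in> space M. \<forall>z\<in>F. \<xi> z \<omega> \<le> h z}"
        using u_solution AE_xi_pos AE_linear_growth
      proof eventually_elim
        case (elim \<omega>)
        interpret pam "\<lambda>z. \<xi> z \<omega>" "u \<omega>"
          by unfold_locales (use elim in \<open>auto intro: less_imp_le\<close>)
        obtain C :: nat where C: "\<And>z. \<xi> z \<omega> \<le> real C + real C * real (l1 z)" using elim(3) by blast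
        have "D < (k - 1) * ?a * y"
          using \<open>max _ _ < ?a\<close> k y by (simp add: D_def field_simps)
        then have "t * (?a * y) < ln (total_mass (u \<omega>) t)" if "z \<in> F" "h z < \<xi> z \<omega>" for z
          using that \<open>1 \<le> k * q * ln t\<close> \<open>ln _ + 1 \<le> _\<close> q_pos
          by (intro ln_total_mass_lower[OF t pos scale_a_times[OF t] k0 y _ _ C, of q])
             (auto simp: F_def h_def)
        then show ?case
          unfolding mem_Collect_eq growth_rate_le_iff[OF t] by (meson not_le)
      qed
    qed (use F in measurable)
    also have "\<dots> \<le> exp (- (\<Sum>z\<in>F. h z powr (- \<alpha>)))"
    proof (rule prob_finite_below_upper[OF F])
      fix z
      have "1 \<le> k * ?a * y" using \<open>max _ _ < ?a\<close> k y by (simp add: field_simps)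
      also have "\<dots> \<le> h z"
        unfolding h_def using k y pos q_pos by (intro mult_left_mono) auto
      finally show "1 \<le> h z" .
    qed
    also have "(\<Sum>z\<in>F. h z powr (- \<alpha>))
        = k powr (- \<alpha>) / ?r ^ CARD('d) * (\<Sum>z\<in>F. (y + q * real (l1 z) / ?r) powr (- \<alpha>))"
      unfolding h_def threshold_powr[OF t k0 y] by (simp add: sum_distrib_left)
    also have "exp (- \<dots>) \<le> exp (- (k powr (- \<alpha>) * (scaled_sum \<alpha> y t - (y + q * ln t) powr (b - \<alpha>) * scaled_sum b y t)))"
    proof -
      have "k powr (- \<alpha>) * (scaled_sum \<alpha> y t - (y + q * ln t) powr (b - \<alpha>) * scaled_sum b y t)
          = k powr (- \<alpha>) / ?r ^ CARD('d) * ((\<Sum>\<^sub>\<infinity>z :: int ^ 'd. (y + q * real (l1 z) / ?r) powr (- \<alpha>))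
     - (y + q * ln t) powr (b - \<alpha>) * (\<Sum>\<^sub>\<infinity>z :: int ^ 'd. (y + q * real (l1 z) / ?r) powr (- b)))"
        by (simp add: scaled_sum_def diff_divide_distrib right_diff_distrib)
      also have "\<dots> \<le> k powr (- \<alpha>) / ?r ^ CARD('d) * (\<Sum>z\<in>F. (y + q * real (l1 z) / ?r) powr (- \<alpha>))"
        unfolding F_def using t pos
        by (intro mult_left_mono truncated_lattice_sum[OF b y q_pos]) auto
      finally show ?thesis by simp
    qed
    finally show ?case .
  qed
qed

text \<open>Both bounds converge as \<open>t\<close> tends to infinity. By homogeneity the factor \<open>k\<close> multiplies the exponent by
\<open>k powr (- \<alpha>)\<close>, which tends to \<open>1\<close> as \<open>k\<close> approaches \<open>1\<close> from either side.\<close>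
lemma tendsto_prob_growth_rate:
  assumes y: "0 < y"
  shows "((\<lambda>t. prob {\<omega> \<in> space M. growth_rate t \<omega> \<le> y}) \<longlongrightarrow> exp (- limit_exponent y)) at_top"
proof -
  have scaled_sum: "((\<lambda>t. scaled_sum \<alpha> y t) \<longlongrightarrow> limit_exponent y) at_top"
    unfolding limit_exponent_eq by (rule scaled_sum_tendsto[OF alpha y])
  have cont: "((\<lambda>k. exp (- (k powr (- \<alpha>) * limit_exponent y))) \<longlongrightarrow> exp (- limit_exponent y)) (at 1 within A)" for A
  proof -
    have "((\<lambda>k. exp (- (k powr (- \<alpha>) * limit_exponent y))) \<longlongrightarrow> exp (- (1 powr (- \<alpha>) * limit_exponent y))) (at 1 within A)"
      by (intro tendsto_intros) auto
    then show ?thesis by simp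
  qed
  show ?thesis
  proof (rule order_tendstoI)
    fix l assume "l < exp (- limit_exponent y)"
    then have "\<forall>\<^sub>F k in at_left 1. l < exp (- (k powr (- \<alpha>) * limit_exponent y))"
      using cont by (rule order_tendstoD(1)[rotated])
    moreover have "\<forall>\<^sub>F k in at_left (1 :: real). k \<in> {0<..<1}"
      by (rule eventually_at_leftI[of 0]) auto
    ultimately have "\<forall>\<^sub>F k in at_left (1 :: real). k \<in> {0<..<1} \<and> l < exp (- (k powr (- \<alpha>) * limit_exponent y))"
      by eventually_elim blast
    from eventually_happens'[OF trivial_limit_at_left_real this]
    obtain k where k: "0 < k" "k < 1" "l < exp (- (k powr (- \<alpha>) * limit_exponent y))" by auto
    have "filterlim (\<lambda>t. k * y * scale_a q t) at_top at_top"
      using k y by (intro filterlim_tendsto_pos_mult_at_top[OF tendsto_const _ scale_a_at_top] q_pos) auto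
    then have "((\<lambda>t. (k * scale_a q t * y) powr (- \<alpha>)) \<longlongrightarrow> 0) at_top"
      using alpha_pos by (intro tendsto_neg_powr) (simp_all add: mult_ac)
    then have "((\<lambda>t. exp (- (k powr (- \<alpha>) * scaled_sum \<alpha> y t) / (1 - (k * scale_a q t * y) powr (- \<alpha>))))
       \<longlongrightarrow> exp (- (k powr (- \<alpha>) * limit_exponent y) / (1 - 0))) at_top"
      by (intro tendsto_intros scaled_sum) auto
    then have "\<forall>\<^sub>F t in at_top. l < exp (- (k powr (- \<alpha>) * scaled_sum \<alpha> y t) / (1 - (k * scale_a q t * y) powr (- \<alpha>)))"
      using k(3) by (intro order_tendstoD) auto
    with prob_lower_bound[OF k(1,2) y]
    show "\<forall>\<^sub>F t in at_top. l < prob {\<omega> \<in> space M. growth_rate t \<omega> \<le> y}"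
      by eventually_elim (rule less_le_trans)
  next
    fix l assume "exp (- limit_exponent y) < l"
    then have "\<forall>\<^sub>F k in at_right 1. exp (- (k powr (- \<alpha>) * limit_exponent y)) < l"
      using cont by (rule order_tendstoD(2)[rotated])
    moreover have "\<forall>\<^sub>F k in at_right (1 :: real). k \<in> {1<..<2}"
      by (rule eventually_at_rightI[of 1 2]) auto
    ultimately have "\<forall>\<^sub>F k in at_right (1 :: real). k \<in> {1<..<2} \<and> exp (- (k powr (- \<alpha>) * limit_exponent y)) < l"
      by eventually_elim blast
    from eventually_happens'[OF trivial_limit_at_right_real this]
    obtain k where k: "1 < k" "exp (- (k powr (- \<alpha>) * limit_exponent y)) < l" by auto
    define b where "b = (real CARD('d) + \<alpha>) / 2"
    have b: "real CARD('d) < b" "b < \<alpha>" using alpha by (simp_all add: b_def)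
    have "filterlim (\<lambda>t. y + q * ln t) at_top at_top"
      using q_pos by real_asymp
    then have "((\<lambda>t. (y + q * ln t) powr (b - \<alpha>)) \<longlongrightarrow> 0) at_top"
      using b by (intro tendsto_neg_powr) auto
    then have "((\<lambda>t. exp (- (k powr (- \<alpha>) * (scaled_sum \<alpha> y t - (y + q * ln t) powr (b - \<alpha>) * scaled_sum b y t))))
       \<longlongrightarrow> exp (- (k powr (- \<alpha>) * (limit_exponent y - 0 * lattice_sum_limit CARD('d) b q y)))) at_top"
      by (intro tendsto_intros scaled_sum scaled_sum_tendsto[OF b(1) y])
    then have "\<forall>\<^sub>F t in at_top. exp (- (k powr (- \<alpha>) * (scaled_sum \<alpha> y t - (y + q * ln t) powr (b - \<alpha>) * scaled_sum b y t))) < l"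
      using k(2) by (intro order_tendstoD) auto
    with prob_upper_bound[OF k(1) y b]
    show "\<forall>\<^sub>F t in at_top. prob {\<omega> \<in> space M. growth_rate t \<omega> \<le> y} < l"
      by eventually_elim (rule le_less_trans)
  qed
qed

lemma exp_limit_exponent_at_0: "((\<lambda>y. exp (- limit_exponent y)) \<longlongrightarrow> 0) (at_right 0)"
proof -
  define e where "e = real CARD('d) - \<alpha>"
  have "e < 0" using alpha by (simp add: e_def)
  moreover have "0 < theta CARD('d) \<alpha>" using alpha by (intro theta_pos) auto
  ultimately show ?thesis
    unfolding limit_exponent_def e_def[symmetric] by real_asymp
qed

text \<open>The limit law gives no mass to the nonpositive numbers, because \<open>exp (- limit_exponent y)\<close> vanishes
as \<open>y\<close> decreases to \<open>0\<close>; monotonicity in the threshold transfers this to the growth rate.\<close>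
lemma tendsto_prob_growth_rate_nonpos:
  assumes "x \<le> 0"
  shows "((\<lambda>t. prob {\<omega> \<in> space M. growth_rate t \<omega> \<le> x}) \<longlongrightarrow> 0) at_top"
proof (rule order_tendstoI)
  fix l :: real assume "l < 0"
  then show "\<forall>\<^sub>F t in at_top. l < prob {\<omega> \<in> space M. growth_rate t \<omega> \<le> x}"
    by (intro always_eventually allI) (rule less_le_trans[OF _ measure_nonneg])
next
  fix l :: real assume "0 < l"
  with exp_limit_exponent_at_0 have "\<forall>\<^sub>F y in at_right 0. exp (- limit_exponent y) < l" by (rule order_tendstoD)
  moreover have "\<forall>\<^sub>F y in at_right (0 :: real). 0 < y" by (rule eventually_at_right_less)
  ultimately have "\<forall>\<^sub>F y in at_right 0. 0 < y \<and> exp (- limit_exponent y) < l" by eventually_elim blast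
  from eventually_happens'[OF trivial_limit_at_right_real this]
  obtain y where y: "0 < y" "exp (- limit_exponent y) < l" by blast
  have "\<forall>\<^sub>F t in at_top. prob {\<omega> \<in> space M. growth_rate t \<omega> \<le> y} < l"
    using tendsto_prob_growth_rate[OF y(1)] y(2) by (rule order_tendstoD)
  with eventually_ge_at_top[of 0]
  show "\<forall>\<^sub>F t in at_top. prob {\<omega> \<in> space M. growth_rate t \<omega> \<le> x} < l"
  proof eventually_elim
    case (elim t)
    have [measurable]: "growth_rate t \<in> borel_measurable M" using elim by (intro growth_rate_measurable)
    have "prob {\<omega> \<in> space M. growth_rate t \<omega> \<le> x} \<le> prob {\<omega> \<in> space M. growth_rate t \<omega> \<le> y}"
      using assms y by (intro finite_measure_mono) auto
    then show ?case using elim by simp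
  qed
qed

end

text \<open>Quantile transform: the variable is the inverse of the prescribed distribution function, evaluated
at a uniform variable. The underlying space is the whole real line, so a positive value is assigned
outside the unit interval as well.\<close>
lemma frechet_variable_exists:
  fixes c b :: real
  assumes c: "0 < c" and b: "b < 0"
  shows "\<exists>(N :: real measure) Y. prob_space N \<and> Y \<in> borel_measurable N \<and> (\<forall>\<omega>\<in>space N. 0 < Y \<omega>) \<and>
           (\<forall>y>0. measure N {\<omega> \<in> space N. Y \<omega> \<le> y} = exp (- c * y powr b))"
proof (intro exI conjI)
  let ?N = "uniform_measure lborel {0<..<1 :: real}"
  define Y :: "real \<Rightarrow> real" where "Y w = (if 0 < w \<and> w < 1 then (- ln w / c) powr (1 / b) else 1)" for w
  show "prob_space ?N" by (rule prob_space_uniform_measure) auto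
  show Y_meas: "Y \<in> borel_measurable ?N" unfolding Y_def[abs_def] by measurable
  show "\<forall>\<omega>\<in>space ?N. 0 < Y \<omega>" using c by (auto simp: Y_def divide_less_0_iff)
  show "\<forall>y>0. measure ?N {\<omega> \<in> space ?N. Y \<omega> \<le> y} = exp (- c * y powr b)"
  proof (intro allI impI)
    fix y :: real assume y: "0 < y"
    define p where "p = exp (- c * y powr b)"
    have p: "0 < p" "p < 1" using c y by (simp_all add: p_def)
    have "Y w \<le> y \<longleftrightarrow> w \<le> p" if w: "0 < w" "w < 1" for w
    proof -
      have pos: "0 < - ln w / c" using w c by (simp add: divide_less_0_iff)
      have "Y w \<le> y \<longleftrightarrow> y powr b \<le> - ln w / c"
      proof
        assume "Y w \<le> y"
        then have "y powr b \<le> Y w powr b"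
          using pos b y w by (intro powr_mono2') (auto simp: Y_def)
        then show "y powr b \<le> - ln w / c" using w pos b by (simp add: Y_def powr_powr)
      next
        assume "y powr b \<le> - ln w / c"
        then have "(- ln w / c) powr (1 / b) \<le> (y powr b) powr (1 / b)"
          using pos b y by (intro powr_mono2') auto
        then show "Y w \<le> y" using w y b by (simp add: Y_def powr_powr)
      qed
      also have "\<dots> \<longleftrightarrow> c * y powr b \<le> - ln w" using c by (simp add: field_simps)
      also have "\<dots> \<longleftrightarrow> ln w \<le> - c * y powr b"
        using le_minus_iff[of "c * y powr b" "ln w"] by simp
      also have "\<dots> \<longleftrightarrow> w \<le> p" unfolding p_def using w by (metis exp_le_cancel_iff exp_ln)
      finally show ?thesis .
    qed
    then have "{0<..<1} \<inter> {w. Y w \<le> y} = {0<..p}" using p by auto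
    moreover have "{w. Y w \<le> y} \<in> sets borel"
      using Y_meas by measurable
    ultimately have "measure ?N {w. Y w \<le> y} = p"
      using p by (simp add: measure_def emeasure_uniform_measure divide_ennreal_def)
    then show "measure ?N {\<omega> \<in> space ?N. Y \<omega> \<le> y} = exp (- c * y powr b)"
      by (simp add: p_def)
  qed
qed

theorem theorem1p2:
  fixes M :: "'a measure"
    and \<xi> :: "int ^ 'd \<Rightarrow> 'a \<Rightarrow> real"
    and u :: "'a \<Rightarrow> real \<Rightarrow> int ^ 'd \<Rightarrow> real"
    and \<alpha> :: real
  assumes "prob_space M"
    and "\<alpha> > real CARD('d)"
    and "prob_space.indep_vars M (\<lambda>_. borel) \<xi> UNIV"
    and "\<And>z x. measure M {\<omega> \<in> space M. \<xi> z \<omega> \<le> x} = (if x < 1 then 0 else 1 - x powr (- \<alpha>))"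
    and "\<And>t z. t \<ge> 0 \<Longrightarrow> (\<lambda>\<omega>. u \<omega> t z) \<in> borel_measurable M"
    and "AE \<omega> in M. pam_nonneg_solution (\<lambda>z. \<xi> z \<omega>) (u \<omega>)"
  shows "\<exists>(N :: real measure) (Y :: real \<Rightarrow> real).
           prob_space N \<and> Y \<in> borel_measurable N \<and> (\<forall>\<omega>\<in>space N. Y \<omega> > 0) \<and>
           (\<forall>y>0. measure N {\<omega> \<in> space N. Y \<omega> \<le> y}
                    = exp (- theta CARD('d) \<alpha> * y powr (real CARD('d) - \<alpha>))) \<and>
           converges_in_law M
             (\<lambda>t \<omega>. (1 / t * ln (total_mass (u \<omega>) t))
                      * (t / ln t) powr (- (real CARD('d) / (\<alpha> - real CARD('d)))))
             at_top N Y"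
proof -
  interpret pam_pareto M \<xi> \<alpha> u
    by (intro pam_pareto.intro pareto_field.intro pareto_field_axioms.intro pam_pareto_axioms.intro assms)
  have "0 < theta CARD('d) \<alpha>" using assms(2) by (intro theta_pos) auto
  moreover have "real CARD('d) - \<alpha> < 0" using assms(2) by simp
  ultimately obtain N :: "real measure" and Y where N: "prob_space N" "Y \<in> borel_measurable N" "\<forall>\<omega>\<in>space N. Y \<omega> > 0"
    and Y: "\<forall>y>0. measure N {\<omega> \<in> space N. Y \<omega> \<le> y}
                    = exp (- theta CARD('d) \<alpha> * y powr (real CARD('d) - \<alpha>))"
    using frechet_variable_exists[of "theta CARD('d) \<alpha>" "real CARD('d) - \<alpha>"] by blast
  have cdf_Y: "cdf (distr N borel Y) x = (if x \<le> 0 then 0 else exp (- limit_exponent x))" for x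
  proof -
    have "cdf (distr N borel Y) x = measure N {\<omega> \<in> space N. Y \<omega> \<le> x}"
      using N(2) by (simp add: cdf_def measure_distr vimage_def Int_def conj_commute)
    moreover have "measure N {\<omega> \<in> space N. Y \<omega> \<le> x} = 0" if "x \<le> 0"
    proof -
      have "{\<omega> \<in> space N. Y \<omega> \<le> x} = {}" using N(3) that by force
      then show ?thesis by (simp only: measure_empty)
    qed
    ultimately show ?thesis using Y by (auto simp: limit_exponent_def)
  qed
  have "converges_in_law M growth_rate at_top N Y"
    unfolding converges_in_law_def
  proof (intro conjI allI impI)
    show "\<forall>\<^sub>F t in at_top. growth_rate t \<in> borel_measurable M"
      using eventually_ge_at_top[of 0] by eventually_elim (rule growth_rate_measurable)
    show "Y \<in> borel_measurable N" by (rule N)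
    fix x
    have "((\<lambda>t. prob {\<omega> \<in> space M. growth_rate t \<omega> \<le> x}) \<longlongrightarrow> cdf (distr N borel Y) x) at_top"
      using tendsto_prob_growth_rate[of x] tendsto_prob_growth_rate_nonpos[of x] by (auto simp: cdf_Y)
    moreover have "\<forall>\<^sub>F t in at_top. prob {\<omega> \<in> space M. growth_rate t \<omega> \<le> x} = cdf (distr M borel (growth_rate t)) x"
      using eventually_ge_at_top[of 0]
    proof eventually_elim
      case (elim t)
      show ?case
        using growth_rate_measurable[OF elim] by (simp add: cdf_def measure_distr vimage_def Int_def conj_commute)
    qed
    ultimately show "((\<lambda>t. cdf (distr M borel (growth_rate t)) x) \<longlongrightarrow> cdf (distr N borel Y) x) at_top"
      by (rule Lim_transform_eventually)
  qed
  then have "converges_in_law M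
             (\<lambda>t \<omega>. (1 / t * ln (total_mass (u \<omega>) t))
                      * (t / ln t) powr (- (real CARD('d) / (\<alpha> - real CARD('d)))))
             at_top N Y"
    unfolding growth_rate_def[abs_def] q_def .
  with N Y show ?thesis by blast
qed

end
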